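(* Let $(X_t)_{t\ge 0}$, $(\mathbb{P}_x)_{x\in E}$ be an irreducible Markov jump process on the finite set $E$ with invariant distribution $\pi$ and generator $L$, let $f:E\to\mathbb{R}$ be non-constant with $\pi(f)=0$, let $\nu$ be a probability measure on $E$, and let $A_t=\int_0^t f(X_s)\,ds$ for $t>0$. Then for all $u\ge 0$ $$\mathbb{P}_\nu\left(\frac{A_t}{t}\ge u\right)\le \left\|\frac{d\nu}{d\pi}\right\|_2 e^{-t\lambda_0^*(u)},$$ where $\lambda_0^*(u)=\sup_{r\in\mathbb{R}}(ru-\lambda_0(r))=\sup_{r\ge 0}(ru-\lambda_0(r))$ for $u\ge 0$ is the Fenchel conjugate of $\lambda_0$. Furthermore, define for $u\in\mathbb{R}$ $$I(u):=\inf\{-\langle Lg,g\rangle \mid g\in L^2(\pi),\ \|g\|_2=1,\ \langle M_f g,g\rangle=u\}.$$ Then $\lambda_0^*(u)=\sup_{r\in\mathbb{R}}(ru-\lambda_0(r))=I(u)$ for all $u\in\mathbb{R}$.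
   Context: $E$ is a finite set with at least two elements. A Markov jump process (MJP) on $E$ is an $E$-valued process $(X_t)_{t\ge0}$ with right-continuous (piecewise constant) paths together with probability measures $(\mathbb{P}_x)_{x\in E}$ such that $\mathbb{P}_x(X_0=x)=1$ and the (time-homogeneous) Markov property holds. Its transition function is $p_{xy}(t)=\mathbb{P}_x(X_t=y)=(\exp(tQ))_{xy}$ for a unique matrix $Q=(q_{xy})$ with $q_{xy}\ge0$ for $x\ne y$ and $\sum_y q_{xy}=0$. It is irreducible if $p_{xy}(t)>0$ for all $x,y\in E$, $t>0$; then it has a unique invariant distribution $\pi$ ($\pi^TQ=0$), and $\pi_x>0$ for all $x$. Write $\mathbb{P}_\nu=\sum_x\nu_x\mathbb{P}_x$ for a probability measure $\nu$ on $E$, and $\mu(g)=\int g\,d\mu$. $L^2(\pi)$ is the real space of all functions $E\to\mathbb{R}$ with inner product $\langle g,h\rangle=\sum_x g(x)h(x)\pi_x$ and norm $\|\cdot\|_2$. The infinitesimal generator $L$ is the operator on $L^2(\pi)$ given by $(Lg)(x)=\sum_y q_{xy}g(y)$, and $L^*$ is its adjoint in $L^2(\pi)$. $M_f$ is multiplication by $f$, and $\frac{d\nu}{d\pi}(x)=\nu_x/\pi_x$. For $r\in\mathbb{R}$, $\lambda_0(r)$ denotes the largest eigenvalue of the self-adjoint operator $\frac{L+L^*}{2}+rM_f$ on $L^2(\pi)$. Conventions: $\inf\emptyset=\infty$, $e^{-\infty}=0$. *)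

theory Defs
  imports "HOL-Probability.Probability"
begin

section \<open>Markov jump processes on a finite state space\<close>

definition natural_filtration :: "'w measure \<Rightarrow> (real \<Rightarrow> 'w \<Rightarrow> 'e) \<Rightarrow> real \<Rightarrow> 'w measure" where
  "natural_filtration M X t =
     sigma (space M) {X s -` B \<inter> space M | s B. 0 \<le> s \<and> s \<le> t}"

definition transition_function ::
    "('e \<Rightarrow> 'w measure) \<Rightarrow> (real \<Rightarrow> 'w \<Rightarrow> 'e) \<Rightarrow> real \<Rightarrow> 'e \<Rightarrow> 'e \<Rightarrow> real" where
  "transition_function P X t x y = measure (P x) {\<omega> \<in> space (P x). X t \<omega> = y}"

text \<open>
  The measure \<open>M\<close> only supplies the underlying measurable space. The process is indexed by
  \<open>real\<close>, but only its values at times \<open>t \<ge> 0\<close> matter. Since the state space is discrete, a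
  path is (right-)continuous at \<open>t\<close> iff it is constant on a (right) neighbourhood of \<open>t\<close>; the
  last two path assumptions say that paths are right-continuous step functions with
  finitely many jumps in every bounded time interval.
\<close>

locale markov_jump_process =
  fixes M :: "'w measure"
    and P :: "'e::finite \<Rightarrow> 'w measure"
    and X :: "real \<Rightarrow> 'w \<Rightarrow> 'e"
  assumes prob_space_P: "prob_space (P x)"
    and sets_P: "sets (P x) = sets M"
    and measurable_X: "0 \<le> t \<Longrightarrow> X t \<in> M \<rightarrow>\<^sub>M count_space UNIV"
    and right_continuous_paths:
      "\<omega> \<in> space M \<Longrightarrow> 0 \<le> t \<Longrightarrow> eventually (\<lambda>s. X s \<omega> = X t \<omega>) (at_right t)"
    and piecewise_constant_paths:
      "\<omega> \<in> space M \<Longrightarrow> finite {s. 0 < s \<and> s \<le> t \<and> \<not> eventually (\<lambda>r. X r \<omega> = X s \<omega>) (at s)}"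
    and initial: "measure (P x) {\<omega> \<in> space (P x). X 0 \<omega> = x} = 1"
    and markov_property:
      "0 \<le> s \<Longrightarrow> 0 \<le> t \<Longrightarrow>
        AE \<omega> in P x.
          real_cond_exp (P x) (natural_filtration M X s) (\<lambda>\<omega>. indicator {y} (X (s + t) \<omega>)) \<omega>
            = transition_function P X t (X s \<omega>) y"

definition irreducible_process :: "('e \<Rightarrow> 'w measure) \<Rightarrow> (real \<Rightarrow> 'w \<Rightarrow> 'e) \<Rightarrow> bool" where
  "irreducible_process P X \<longleftrightarrow> (\<forall>x y. \<forall>t>0. 0 < transition_function P X t x y)"

text \<open>Powers are spelled out because \<open>*\<close> and \<open>^\<close> on type \<open>vec\<close> are not the matrix operations.\<close>

definition matrix_exp :: "real^'n^'n \<Rightarrow> real^'n^'n" where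
  "matrix_exp A = (\<Sum>n. (1 / fact n) *\<^sub>R (((**) A ^^ n) (mat 1)))"

definition is_Q_matrix :: "real^'e^'e \<Rightarrow> bool" where
  "is_Q_matrix Q \<longleftrightarrow> (\<forall>x y. x \<noteq> y \<longrightarrow> 0 \<le> Q $ x $ y) \<and> (\<forall>x. (\<Sum>y\<in>UNIV. Q $ x $ y) = 0)"

text \<open>
  \<open>Q\<close> is the (unique) matrix generating the transition function; the infinitesimal generator of
  the process is then the operator \<open>(*v) Q\<close>.
\<close>

definition has_Q_matrix :: "('e::finite \<Rightarrow> 'w measure) \<Rightarrow> (real \<Rightarrow> 'w \<Rightarrow> 'e) \<Rightarrow> real^'e^'e \<Rightarrow> bool" where
  "has_Q_matrix P X Q \<longleftrightarrow> is_Q_matrix Q \<and>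
     (\<forall>t\<ge>0. \<forall>x y. transition_function P X t x y = matrix_exp (t *\<^sub>R Q) $ x $ y)"

definition invariant_distribution :: "real^'e^'e \<Rightarrow> 'e::finite pmf \<Rightarrow> bool" where
  "invariant_distribution Q \<pi> \<longleftrightarrow> (\<chi> x. pmf \<pi> x) v* Q = 0"

definition mixture_prob :: "'e pmf \<Rightarrow> ('e::finite \<Rightarrow> 'w measure) \<Rightarrow> 'w set \<Rightarrow> real" where
  "mixture_prob \<nu> P A = (\<Sum>x\<in>UNIV. pmf \<nu> x * measure (P x) A)"

definition additive_functional ::
    "(real \<Rightarrow> 'w \<Rightarrow> 'e) \<Rightarrow> ('e \<Rightarrow> real) \<Rightarrow> real \<Rightarrow> 'w \<Rightarrow> real" where
  "additive_functional X f t \<omega> = (LINT s:{0..t}|lborel. f (X s \<omega>))"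


section \<open>The weighted space of functions on the state space\<close>

text \<open>Functions on the state space, as elements of the weighted space, have type \<open>real^'e\<close>.\<close>

definition l2_inner :: "'e pmf \<Rightarrow> real^'e \<Rightarrow> real^'e \<Rightarrow> real" where
  "l2_inner \<pi> g h = (\<Sum>x\<in>UNIV. g $ x * h $ x * pmf \<pi> x)"

definition l2_norm :: "'e pmf \<Rightarrow> real^'e \<Rightarrow> real" where
  "l2_norm \<pi> g = sqrt (l2_inner \<pi> g g)"

text \<open>The adjoint is uniquely determined when \<open>\<pi>\<close> charges every point.\<close>

definition l2_adjoint :: "'e pmf \<Rightarrow> (real^'e \<Rightarrow> real^'e) \<Rightarrow> real^'e \<Rightarrow> real^'e" where
  "l2_adjoint \<pi> T = (THE S. \<forall>g h. l2_inner \<pi> (T g) h = l2_inner \<pi> g (S h))"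

definition mult_op :: "('e \<Rightarrow> real) \<Rightarrow> real^'e \<Rightarrow> real^'e" where
  "mult_op f g = (\<chi> x. f x * g $ x)"

definition rn_density :: "'e pmf \<Rightarrow> 'e pmf \<Rightarrow> real^'e" where
  "rn_density \<nu> \<pi> = (\<chi> x. pmf \<nu> x / pmf \<pi> x)"

definition is_eigenvalue :: "(real^'e \<Rightarrow> real^'e) \<Rightarrow> real \<Rightarrow> bool" where
  "is_eigenvalue T c \<longleftrightarrow> (\<exists>g. g \<noteq> 0 \<and> T g = c *\<^sub>R g)"

definition lambda0 :: "'e pmf \<Rightarrow> (real^'e \<Rightarrow> real^'e) \<Rightarrow> ('e \<Rightarrow> real) \<Rightarrow> real \<Rightarrow> real" where
  "lambda0 \<pi> L f r =
     (GREATEST c. is_eigenvalue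
        (\<lambda>g. (1 / 2) *\<^sub>R (L g + l2_adjoint \<pi> L g) + r *\<^sub>R mult_op f g) c)"

definition fenchel_conjugate :: "(real \<Rightarrow> real) \<Rightarrow> real \<Rightarrow> ereal" where
  "fenchel_conjugate \<phi> u = (SUP r. ereal (r * u - \<phi> r))"

text \<open>The infimum in \<open>ereal\<close> of the empty set is \<open>\<infinity>\<close>.\<close>

definition rate_I :: "'e pmf \<Rightarrow> (real^'e \<Rightarrow> real^'e) \<Rightarrow> ('e \<Rightarrow> real) \<Rightarrow> real \<Rightarrow> ereal" where
  "rate_I \<pi> L f u =
     (INF g \<in> {g. l2_norm \<pi> g = 1 \<and> l2_inner \<pi> (mult_op f g) g = u}. ereal (- l2_inner \<pi> (L g) g))"

definition exp_ereal :: "ereal \<Rightarrow> ereal" where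
  "exp_ereal a = (if a = \<infinity> then \<infinity> else if a = -\<infinity> then 0 else ereal (exp (real_of_ereal a)))"

end

theory Submission
  imports Defs
begin

text \<open>
  The tail bound is Chernoff's inequality applied to the exponential moments of \<open>A\<^sub>t\<close>. Write \<open>A\<^sub>t\<close> as
  the limit of the Riemann sums \<open>h (f (X\<^sub>h) + \<dots> + f (X\<^sub>n\<^sub>h))\<close> with \<open>h = t / n\<close>. By the Markov property,
  the exponential moment of \<open>r\<close> times such a sum, started at \<open>x\<close>, is the \<open>x\<close>-entry of \<open>S\<^sub>h\<^sup>n 1\<close>, where
  \<open>S\<^sub>h = exp (h Q) exp (h r M\<^sub>f)\<close> (lemma \<open>expectation_path_product\<close>). To first order \<open>S\<^sub>h\<close> is the
  identity plus \<open>h (Q + r M\<^sub>f)\<close>, and the derivative of \<open>\<parallel>S\<^sub>h g\<parallel>\<^sup>2\<close> at \<open>h = 0\<close> is twice the quadratic form of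
  \<open>Q + r M\<^sub>f\<close>, which is at most \<open>2 \<lambda>\<^sub>0 r \<parallel>g\<parallel>\<^sup>2\<close> by the variational description of the largest eigenvalue.
  So \<open>\<parallel>S\<^sub>h\<^sup>n\<parallel>\<close> is asymptotically at most \<open>exp (t \<lambda>\<^sub>0 r)\<close> (lemma \<open>norm_growth_products\<close>), and pairing
  \<open>S\<^sub>h\<^sup>n 1\<close> with the density of \<open>\<nu>\<close> by Cauchy-Schwarz bounds the moment under \<open>\<nu>\<close>
  (lemma \<open>exp_moment_bound\<close>). Chernoff's inequality permits \<open>r \<ge> 0\<close> only, but for \<open>u \<ge> 0\<close> the
  supremum over these \<open>r\<close> is the full conjugate, since \<open>\<lambda>\<^sub>0\<close> is nonnegative and vanishes at \<open>0\<close>.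

  For the identity with \<open>I\<close>, recall that \<open>\<lambda>\<^sub>0 r\<close> is the maximum of \<open>\<langle>L g, g\<rangle> + r \<langle>f g, g\<rangle>\<close> over the unit
  sphere; thus \<open>\<lambda>\<^sub>0\<close> is the conjugate of \<open>I\<close>, and the claim is that \<open>I\<close> equals its own biconjugate, that is,
  that \<open>I\<close> is convex and lower semicontinuous. The latter is compactness of the sphere. Convexity
  comes from averaging the squares of two functions: the map \<open>g \<mapsto> g\<^sup>2\<close> turns the constraint
  \<open>\<langle>f g, g\<rangle> = u\<close> into a linear one, and the energy \<open>- \<langle>L g, g\<rangle>\<close> is convex in \<open>g\<^sup>2\<close> because the off-diagonal
  rates are nonnegative (lemma \<open>energy_convex_in_squares\<close>). A separating line for the epigraph
  finishes the argument.
\<close>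


section \<open>The weighted inner product\<close>

lemma l2_inner_commute: "l2_inner \<pi> g h = l2_inner \<pi> h g"
  by (simp add: l2_inner_def mult.commute mult.left_commute)

lemma l2_inner_add_left: "l2_inner \<pi> (g + g') h = l2_inner \<pi> g h + l2_inner \<pi> g' h"
  by (simp add: l2_inner_def distrib_right sum.distrib)

lemma l2_inner_scaleR_left: "l2_inner \<pi> (c *\<^sub>R g) h = c * l2_inner \<pi> g h"
  by (simp add: l2_inner_def sum_distrib_left algebra_simps)

lemma l2_inner_diff_left: "l2_inner \<pi> (g - g') h = l2_inner \<pi> g h - l2_inner \<pi> g' h"
  by (simp add: l2_inner_def left_diff_distrib sum_subtractf)

lemma l2_inner_add_right: "l2_inner \<pi> h (g + g') = l2_inner \<pi> h g + l2_inner \<pi> h g'"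
  by (simp add: l2_inner_def algebra_simps sum.distrib)

lemma l2_inner_scaleR_right: "l2_inner \<pi> h (c *\<^sub>R g) = c * l2_inner \<pi> h g"
  by (simp add: l2_inner_def sum_distrib_left algebra_simps)

lemma l2_inner_diff_right: "l2_inner \<pi> h (g - g') = l2_inner \<pi> h g - l2_inner \<pi> h g'"
  by (simp add: l2_inner_def algebra_simps sum_subtractf)

lemmas l2_inner_linear =
  l2_inner_add_left l2_inner_scaleR_left l2_inner_diff_left
  l2_inner_add_right l2_inner_scaleR_right l2_inner_diff_right

lemma l2_inner_self_nonneg: "0 \<le> l2_inner \<pi> g g"
  by (simp add: l2_inner_def sum_nonneg)

lemma l2_norm_nonneg: "0 \<le> l2_norm \<pi> g"
  by (simp add: l2_norm_def l2_inner_self_nonneg)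

lemma l2_norm_square: "(l2_norm \<pi> g)\<^sup>2 = l2_inner \<pi> g g"
  by (simp add: l2_norm_def l2_inner_self_nonneg)

lemma l2_norm_eq_1_iff: "l2_norm \<pi> g = 1 \<longleftrightarrow> l2_inner \<pi> g g = 1"
  by (simp add: l2_norm_def)

lemma l2_inner_eq_inner:
  "l2_inner \<pi> g h = (\<chi> x. sqrt (pmf \<pi> x) * g $ x) \<bullet> (\<chi> x. sqrt (pmf \<pi> x) * h $ x)"
  by (simp add: l2_inner_def inner_vec_def algebra_simps flip: power2_eq_square)

lemma l2_norm_eq_norm: "l2_norm \<pi> g = norm (\<chi> x. sqrt (pmf \<pi> x) * g $ x)"
  by (simp add: l2_norm_def l2_inner_eq_inner norm_eq_sqrt_inner)

lemma l2_cauchy_schwarz: "l2_inner \<pi> g h \<le> l2_norm \<pi> g * l2_norm \<pi> h"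
  unfolding l2_inner_eq_inner l2_norm_eq_norm by (rule norm_cauchy_schwarz)

lemma sum_pmf_UNIV: "(\<Sum>x\<in>UNIV. pmf \<pi> (x::'e::finite)) = 1"
  by (rule sum_pmf_eq_1) auto

lemma l2_norm_one: "l2_norm \<pi> (\<chi> x. 1) = 1"
  by (simp add: l2_norm_def l2_inner_def sum_pmf_UNIV)

lemma l2_inner_matrix:
  "l2_inner \<pi> (A *v g) h = (\<Sum>x\<in>UNIV. \<Sum>y\<in>UNIV. pmf \<pi> x * A $ x $ y * g $ y * h $ x)"
  by (simp add: l2_inner_def matrix_vector_mult_def sum_distrib_left sum_distrib_right algebra_simps)

lemma l2_inner_mult_op: "l2_inner \<pi> (mult_op f g) h = (\<Sum>x\<in>UNIV. f x * g $ x * h $ x * pmf \<pi> x)"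
  by (simp add: l2_inner_def mult_op_def)

lemma linear_mult_op: "linear (mult_op f)"
  by (rule linearI) (simp_all add: mult_op_def vec_eq_iff algebra_simps)

lemma continuous_on_l2_inner [continuous_intros]:
  "continuous_on S a \<Longrightarrow> continuous_on S b \<Longrightarrow> continuous_on S (\<lambda>x. l2_inner \<pi> (a x) (b x))"
  unfolding l2_inner_def by (intro continuous_intros)

context
  fixes \<pi> :: "'e::finite pmf"
  assumes pos: "\<And>x. 0 < pmf \<pi> x"
begin

lemma l2_inner_self_eq_0_iff: "l2_inner \<pi> g g = 0 \<longleftrightarrow> g = 0"
proof -
  have "l2_inner \<pi> g g = 0 \<longleftrightarrow> (\<forall>x\<in>UNIV. g $ x * g $ x * pmf \<pi> x = 0)"
    unfolding l2_inner_def by (rule sum_nonneg_eq_0_iff) auto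
  also have "\<dots> \<longleftrightarrow> g = 0"
    using pos by (auto simp: vec_eq_iff less_le)
  finally show ?thesis .
qed

lemma l2_inner_self_pos: "g \<noteq> 0 \<Longrightarrow> 0 < l2_inner \<pi> g g"
  using l2_inner_self_nonneg[of \<pi> g] l2_inner_self_eq_0_iff[of g] by linarith

lemma l2_inner_extensionality:
  assumes "\<And>g. l2_inner \<pi> g a = l2_inner \<pi> g b"
  shows "a = b"
proof -
  have "l2_inner \<pi> (a - b) (a - b) = 0"
    using assms[of "a - b"] by (simp add: l2_inner_diff_right)
  then show ?thesis
    by (simp add: l2_inner_self_eq_0_iff)
qed

text \<open>
  The unit sphere is the image of the Euclidean one under the linear map that divides coordinate
  \<open>x\<close> by \<open>sqrt (pmf \<pi> x)\<close>, hence compact.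
\<close>

lemma compact_l2_sphere: "compact {g. l2_norm \<pi> g = 1}"
proof -
  let ?D = "\<lambda>h::real^'e. (\<chi> x. h $ x / sqrt (pmf \<pi> x)) :: real^'e"
  have nz: "sqrt (pmf \<pi> x) \<noteq> 0" for x
    using pos[of x] by simp
  have "?D ` sphere 0 1 = {g. l2_norm \<pi> g = 1}"
  proof (intro equalityI subsetI)
    fix g assume "g \<in> ?D ` sphere 0 1"
    then obtain h where h: "norm h = 1" "g = ?D h" by auto
    have "(\<chi> x. sqrt (pmf \<pi> x) * g $ x) = h"
      using h(2) nz by (simp add: vec_eq_iff)
    then show "g \<in> {g. l2_norm \<pi> g = 1}"
      using h(1) by (simp add: l2_norm_eq_norm)
  next
    fix g assume "g \<in> {g. l2_norm \<pi> g = 1}"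
    then have "(\<chi> x. sqrt (pmf \<pi> x) * g $ x) \<in> sphere 0 1"
      by (simp add: l2_norm_eq_norm)
    moreover have "g = ?D (\<chi> x. sqrt (pmf \<pi> x) * g $ x)"
      using nz by (simp add: vec_eq_iff)
    ultimately show "g \<in> ?D ` sphere 0 1" by blast
  qed
  moreover have "compact (?D ` sphere 0 1)"
    by (intro compact_continuous_image continuous_on_vec_lambda continuous_intros) (use nz in auto)
  ultimately show ?thesis by simp
qed

text \<open>
  With \<open>\<pi>\<close> charging every point, the adjoint of a matrix is the transpose conjugated with the
  weights; uniqueness is nondegeneracy of the inner product.
\<close>

lemma l2_adjoint_matrix:
  "l2_inner \<pi> ((*v) A g) h = l2_inner \<pi> g (l2_adjoint \<pi> ((*v) A) h)"
proof -
  define S :: "real^'e \<Rightarrow> real^'e"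
    where "S h = (\<chi> y. (\<Sum>x\<in>UNIV. pmf \<pi> x * A $ x $ y * h $ x) / pmf \<pi> y)" for h
  have nz: "pmf \<pi> x \<noteq> 0" for x
    using pos[of x] by simp
  have S: "l2_inner \<pi> ((*v) A g) h = l2_inner \<pi> g (S h)" for g h
  proof -
    have "l2_inner \<pi> (A *v g) h = (\<Sum>y\<in>UNIV. \<Sum>x\<in>UNIV. pmf \<pi> x * A $ x $ y * g $ y * h $ x)"
      unfolding l2_inner_matrix by (rule sum.swap)
    also have "\<dots> = (\<Sum>y\<in>UNIV. g $ y * (\<Sum>x\<in>UNIV. pmf \<pi> x * A $ x $ y * h $ x))"
      by (simp add: sum_distrib_left mult_ac)
    also have "\<dots> = l2_inner \<pi> g (S h)"
      using nz by (simp add: l2_inner_def S_def sum_distrib_left[symmetric] mult_ac)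
    finally show ?thesis .
  qed
  have "\<forall>g h. l2_inner \<pi> ((*v) A g) h = l2_inner \<pi> g (l2_adjoint \<pi> ((*v) A) h)"
    unfolding l2_adjoint_def
  proof (rule theI[of _ S])
    show "\<forall>g h. l2_inner \<pi> ((*v) A g) h = l2_inner \<pi> g (S h)"
      using S by blast
    fix S' assume "\<forall>g h. l2_inner \<pi> ((*v) A g) h = l2_inner \<pi> g (S' h)"
    then show "S' = S"
      using S by (intro ext l2_inner_extensionality) metis
  qed
  then show ?thesis by blast
qed


section \<open>The largest eigenvalue as the maximum of the Rayleigh quotient\<close>

text \<open>
  On the compact unit sphere the quadratic form attains its maximum \<open>c\<close>, at \<open>g\<close> say. The form
  \<open>c \<langle>h, h\<rangle> - \<langle>T h, h\<rangle>\<close> is then nonnegative and vanishes at \<open>g\<close>, so its first variation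
  \<open>2 \<langle>c g - T g, h\<rangle>\<close> at \<open>g\<close> vanishes in every direction \<open>h\<close>, that is, \<open>T g = c g\<close>.
\<close>

lemma rayleigh_greatest_eigenvalue:
  assumes lin: "linear T" and sym: "\<And>g h. l2_inner \<pi> (T g) h = l2_inner \<pi> g (T h)"
  defines "c \<equiv> (GREATEST c. is_eigenvalue T c)"
  shows "\<And>g. l2_inner \<pi> (T g) g \<le> c * l2_inner \<pi> g g"
    and "\<exists>g. l2_norm \<pi> g = 1 \<and> l2_inner \<pi> (T g) g = c"
proof -
  have "continuous_on {g. l2_norm \<pi> g = 1} T"
    using lin by (simp add: linear_continuous_on linear_linear)
  then have "continuous_on {g. l2_norm \<pi> g = 1} (\<lambda>g. l2_inner \<pi> (T g) g)"
    by (intro continuous_intros)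
  moreover have "{g. l2_norm \<pi> g = 1} \<noteq> {}"
    using l2_norm_one[of \<pi>] by blast
  ultimately obtain g where g: "l2_norm \<pi> g = 1"
    and gmax: "\<And>h. l2_norm \<pi> h = 1 \<Longrightarrow> l2_inner \<pi> (T h) h \<le> l2_inner \<pi> (T g) g"
    using continuous_attains_sup[OF compact_l2_sphere] by blast
  define m where "m = l2_inner \<pi> (T g) g"
  have gg: "l2_inner \<pi> g g = 1"
    using g by (simp add: l2_norm_eq_1_iff)
  have upper: "l2_inner \<pi> (T h) h \<le> m * l2_inner \<pi> h h" for h
  proof (cases "h = 0")
    case True
    then show ?thesis by (simp add: l2_inner_def)
  next
    case False
    define a where "a = 1 / l2_norm \<pi> h"
    have p: "0 < l2_inner \<pi> h h"
      using False by (rule l2_inner_self_pos)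
    have a2: "a * a = 1 / l2_inner \<pi> h h"
      using p by (simp add: a_def l2_norm_def)
    have "l2_inner \<pi> (a *\<^sub>R h) (a *\<^sub>R h) = 1"
      using p a2 by (simp add: l2_inner_linear flip: mult.assoc)
    then have "l2_inner \<pi> (T (a *\<^sub>R h)) (a *\<^sub>R h) \<le> m"
      using gmax[of "a *\<^sub>R h"] by (simp add: m_def l2_norm_eq_1_iff)
    then have "l2_inner \<pi> (T h) h / l2_inner \<pi> h h \<le> m"
      using a2 by (simp add: linear_cmul[OF lin] l2_inner_linear flip: mult.assoc)
    then show ?thesis
      using p by (simp add: field_simps)
  qed
  have eig: "T g = m *\<^sub>R g"
  proof -
    \<comment> \<open>The residual itself is the direction in which the first variation is its squared norm.\<close>
    define k where "k = m *\<^sub>R g - T g"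
    define b where "b = l2_inner \<pi> k k"
    define q where "q = m * l2_inner \<pi> k k - l2_inner \<pi> (T k) k"
    have q0: "0 \<le> q"
      using upper[of k] by (simp add: q_def)
    have "0 \<le> 2 * t * b + t * t * q" for t
    proof -
      have "0 \<le> m * l2_inner \<pi> (g + t *\<^sub>R k) (g + t *\<^sub>R k)
          - l2_inner \<pi> (T (g + t *\<^sub>R k)) (g + t *\<^sub>R k)"
        using upper[of "g + t *\<^sub>R k"] by simp
      also have "\<dots> = 2 * t * (m * l2_inner \<pi> g k - l2_inner \<pi> (T g) k) + t * t * q"
        using gg m_def sym[of k g] l2_inner_commute[of \<pi> k g] l2_inner_commute[of \<pi> k "T g"]
        by (simp add: linear_add[OF lin] linear_cmul[OF lin] l2_inner_add_left l2_inner_add_right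
            l2_inner_scaleR_left l2_inner_scaleR_right q_def) (simp add: algebra_simps)
      also have "m * l2_inner \<pi> g k - l2_inner \<pi> (T g) k = l2_inner \<pi> (m *\<^sub>R g - T g) k"
        by (simp add: l2_inner_diff_left l2_inner_scaleR_left)
      also have "\<dots> = b"
        by (simp add: b_def k_def)
      finally show ?thesis .
    qed
    \<comment> \<open>Shifting the denominator by one avoids the case \<open>q = 0\<close>.\<close>
    moreover define t where "t = - b / (q + 1)"
    moreover have b: "b = - t * (q + 1)"
      using q0 by (simp add: t_def)
    ultimately have "0 \<le> 2 * t * (- t * (q + 1)) + t * t * q"
      by metis
    then have "t * t * (q + 2) \<le> 0"
      by (simp add: algebra_simps)
    then have "t * t \<le> 0"
      using q0 by (simp add: mult_le_0_iff)
    then have "t = 0"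
      by (metis mult_eq_0_iff order_antisym zero_le_square)
    then have "b = 0"
      using b by simp
    then show ?thesis
      by (simp add: b_def k_def l2_inner_self_eq_0_iff)
  qed
  have "c = m"
    unfolding c_def
  proof (rule Greatest_equality)
    have "g \<noteq> 0" using gg by (auto simp: l2_inner_def)
    then show "is_eigenvalue T m"
      using eig by (auto simp: is_eigenvalue_def)
    fix d assume "is_eigenvalue T d"
    then obtain h where h: "h \<noteq> 0" "T h = d *\<^sub>R h"
      by (auto simp: is_eigenvalue_def)
    then have "d * l2_inner \<pi> h h \<le> m * l2_inner \<pi> h h"
      using upper[of h] by (simp add: l2_inner_linear)
    then show "d \<le> m"
      using l2_inner_self_pos[OF h(1)] by simp
  qed
  then show "\<And>g. l2_inner \<pi> (T g) g \<le> c * l2_inner \<pi> g g"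
    and "\<exists>g. l2_norm \<pi> g = 1 \<and> l2_inner \<pi> (T g) g = c"
    using upper g m_def by auto
qed

text \<open>
  An operator and its symmetric part have the same quadratic form, so the adjoint disappears from
  the variational formula.
\<close>

lemma lambda0_variational:
  fixes Q :: "real^'e^'e"
  shows "l2_inner \<pi> (Q *v g) g + r * l2_inner \<pi> (mult_op f g) g
      \<le> lambda0 \<pi> ((*v) Q) f r * l2_inner \<pi> g g"
    and "\<exists>g. l2_norm \<pi> g = 1 \<and>
      l2_inner \<pi> (Q *v g) g + r * l2_inner \<pi> (mult_op f g) g = lambda0 \<pi> ((*v) Q) f r"
proof -
  define S where "S = l2_adjoint \<pi> ((*v) Q)"
  have adj: "l2_inner \<pi> (Q *v g) h = l2_inner \<pi> g (S h)" for g h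
    unfolding S_def by (rule l2_adjoint_matrix)
  have linS: "linear S"
  proof (rule linearI)
    show "S (a + b) = S a + S b" for a b
      by (rule l2_inner_extensionality) (simp add: l2_inner_add_right flip: adj)
    show "S (c *\<^sub>R a) = c *\<^sub>R S a" for c a
      by (rule l2_inner_extensionality) (simp add: l2_inner_scaleR_right flip: adj)
  qed
  define T where "T g = (1 / 2) *\<^sub>R (Q *v g + S g) + r *\<^sub>R mult_op f g" for g
  have lam: "lambda0 \<pi> ((*v) Q) f r = (GREATEST c. is_eigenvalue T c)"
    unfolding lambda0_def T_def S_def ..
  have "linear T"
    unfolding T_def
    by (intro linear_compose_add linear_compose_scale_right linear_mult_op linS
        matrix_vector_mul_linear)
  moreover have mo: "l2_inner \<pi> (mult_op f g) h = l2_inner \<pi> g (mult_op f h)" for g h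
    by (simp add: l2_inner_def mult_op_def algebra_simps)
  have "l2_inner \<pi> (T g) h = l2_inner \<pi> g (T h)" for g h
    using adj[of g h] adj[of h g] mo[of g h] l2_inner_commute[of \<pi> h "S g"]
      l2_inner_commute[of \<pi> "Q *v h" g]
    by (simp add: T_def l2_inner_linear)
  ultimately have *: "\<And>g. l2_inner \<pi> (T g) g \<le> lambda0 \<pi> ((*v) Q) f r * l2_inner \<pi> g g"
    "\<exists>g. l2_norm \<pi> g = 1 \<and> l2_inner \<pi> (T g) g = lambda0 \<pi> ((*v) Q) f r"
    using rayleigh_greatest_eigenvalue[of T] unfolding lam by blast+
  have T: "l2_inner \<pi> (T g) g = l2_inner \<pi> (Q *v g) g + r * l2_inner \<pi> (mult_op f g) g" for g
    using adj[of g g] l2_inner_commute[of \<pi> g "S g"] by (simp add: T_def l2_inner_linear)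
  show "l2_inner \<pi> (Q *v g) g + r * l2_inner \<pi> (mult_op f g) g
      \<le> lambda0 \<pi> ((*v) Q) f r * l2_inner \<pi> g g"
    and "\<exists>g. l2_norm \<pi> g = 1 \<and>
      l2_inner \<pi> (Q *v g) g + r * l2_inner \<pi> (mult_op f g) g = lambda0 \<pi> ((*v) Q) f r"
    using * T by auto
qed


section \<open>The Fenchel conjugate of the largest eigenvalue\<close>

text \<open>
  Off the diagonal \<open>g x g y \<le> (g x\<^sup>2 + g y\<^sup>2) / 2\<close>, with equality on the diagonal. The two halves of the
  resulting sum vanish, one because the rows of \<open>Q\<close> sum to zero, the other because \<open>\<pi>\<close> is invariant.
\<close>

lemma generator_dissipative:
  assumes Q: "is_Q_matrix Q" and inv: "invariant_distribution Q \<pi>"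
  shows "l2_inner \<pi> (Q *v g) g \<le> 0"
proof -
  have rows: "(\<Sum>y\<in>UNIV. Q $ x $ y) = 0" for x
    using Q by (simp add: is_Q_matrix_def)
  have cols: "(\<Sum>x\<in>UNIV. pmf \<pi> x * Q $ x $ y) = 0" for y
    using inv by (simp add: invariant_distribution_def vector_matrix_mult_def vec_eq_iff mult.commute)
  let ?s = "\<lambda>x y. pmf \<pi> x * Q $ x $ y * ((g $ x)\<^sup>2 / 2 + (g $ y)\<^sup>2 / 2)"
  have "l2_inner \<pi> (Q *v g) g \<le> (\<Sum>x\<in>UNIV. \<Sum>y\<in>UNIV. ?s x y)"
    unfolding l2_inner_matrix
  proof (intro sum_mono)
    fix x y
    show "pmf \<pi> x * Q $ x $ y * g $ y * g $ x \<le> ?s x y"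
    proof (cases "x = y")
      case True
      then show ?thesis by (simp add: power2_eq_square)
    next
      case False
      have "g $ y * g $ x \<le> (g $ x)\<^sup>2 / 2 + (g $ y)\<^sup>2 / 2"
        using sum_squares_bound[of "g $ y" "g $ x"] by linarith
      moreover have "0 \<le> pmf \<pi> x * Q $ x $ y"
        using False Q by (simp add: is_Q_matrix_def)
      ultimately have "pmf \<pi> x * Q $ x $ y * (g $ y * g $ x) \<le> ?s x y"
        by (rule mult_left_mono)
      then show ?thesis by (simp add: mult.assoc)
    qed
  qed
  also have "\<dots> = (\<Sum>x\<in>UNIV. \<Sum>y\<in>UNIV. (pmf \<pi> x * (g $ x)\<^sup>2 / 2) * Q $ x $ y)
      + (\<Sum>x\<in>UNIV. \<Sum>y\<in>UNIV. ((g $ y)\<^sup>2 / 2) * (pmf \<pi> x * Q $ x $ y))"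
    by (simp add: algebra_simps flip: sum.distrib)
  also have "(\<Sum>x\<in>UNIV. \<Sum>y\<in>UNIV. ((g $ y)\<^sup>2 / 2) * (pmf \<pi> x * Q $ x $ y))
      = (\<Sum>y\<in>UNIV. \<Sum>x\<in>UNIV. ((g $ y)\<^sup>2 / 2) * (pmf \<pi> x * Q $ x $ y))"
    by (rule sum.swap)
  finally show ?thesis
    by (simp only: rows cols flip: sum_distrib_left) simp
qed

lemma lambda0_at_0:
  assumes Q: "is_Q_matrix Q" and inv: "invariant_distribution Q \<pi>"
  shows "lambda0 \<pi> ((*v) Q) f 0 \<le> 0"
proof -
  obtain g where "l2_inner \<pi> (Q *v g) g = lambda0 \<pi> ((*v) Q) f 0"
    using lambda0_variational(2)[of Q 0 f] by auto
  then show ?thesis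
    using generator_dissipative[OF assms, of g] by linarith
qed

text \<open>Constants are test functions: \<open>Q\<close> annihilates them, and \<open>f\<close> has mean zero.\<close>

lemma lambda0_nonneg:
  assumes Q: "is_Q_matrix Q" and f0: "(\<Sum>x\<in>UNIV. f x * pmf \<pi> x) = 0"
  shows "0 \<le> lambda0 \<pi> ((*v) Q) f r"
proof -
  have "Q *v (\<chi> x. 1) = 0"
    using Q by (simp add: is_Q_matrix_def matrix_vector_mult_def vec_eq_iff)
  then show ?thesis
    using lambda0_variational(1)[of Q "\<chi> x. 1" r f] l2_norm_one[of \<pi>] f0
    by (simp add: l2_norm_eq_1_iff l2_inner_mult_op) (simp add: l2_inner_def)
qed

text \<open>
  The function \<open>\<lambda>\<^sub>0\<close> is nonnegative and vanishes at \<open>0\<close>, so for \<open>u \<ge> 0\<close> negative slopes do no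
  better than slope \<open>0\<close>.
\<close>

lemma fenchel_conjugate_lambda0_nonneg_slopes:
  assumes Q: "is_Q_matrix Q" and inv: "invariant_distribution Q \<pi>"
    and f0: "(\<Sum>x\<in>UNIV. f x * pmf \<pi> x) = 0" and u: "0 \<le> u"
  shows "fenchel_conjugate (lambda0 \<pi> ((*v) Q) f) u
    = (SUP r\<in>{0..}. ereal (r * u - lambda0 \<pi> ((*v) Q) f r))"
  unfolding fenchel_conjugate_def
proof (rule antisym)
  show "(SUP r\<in>{0..}. ereal (r * u - lambda0 \<pi> ((*v) Q) f r))
      \<le> (SUP r. ereal (r * u - lambda0 \<pi> ((*v) Q) f r))"
    by (rule SUP_subset_mono) auto
  show "(SUP r. ereal (r * u - lambda0 \<pi> ((*v) Q) f r))
      \<le> (SUP r\<in>{0..}. ereal (r * u - lambda0 \<pi> ((*v) Q) f r))"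
  proof (rule SUP_least)
    fix r :: real
    have "r * u - lambda0 \<pi> ((*v) Q) f r
        \<le> max 0 r * u - lambda0 \<pi> ((*v) Q) f (max 0 r)"
      using lambda0_nonneg[OF Q f0, of r] lambda0_at_0[OF Q inv, of f]
        mult_nonpos_nonneg[of r u] u by (auto simp: max_def)
    then have "ereal (r * u - lambda0 \<pi> ((*v) Q) f r)
        \<le> ereal (max 0 r * u - lambda0 \<pi> ((*v) Q) f (max 0 r))"
      by simp
    also have "\<dots> \<le> (SUP r\<in>{0..}. ereal (r * u - lambda0 \<pi> ((*v) Q) f r))"
      by (rule SUP_upper) auto
    finally show "ereal (r * u - lambda0 \<pi> ((*v) Q) f r)
        \<le> (SUP r\<in>{0..}. ereal (r * u - lambda0 \<pi> ((*v) Q) f r))" .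
  qed
qed

text \<open>
  The mean of two functions whose squares are averaged: \<open>k\<^sup>2 = a g\<^sup>2 + b h\<^sup>2\<close>. Quadratic
  expressions on the diagonal are averaged exactly, whereas off the diagonal
  \<open>k x k y \<ge> a g x g y + b h x h y\<close> by Cauchy-Schwarz in the plane. As the off-diagonal rates are
  nonnegative, the energy is convex along this mean.
\<close>

lemma energy_convex_in_squares:
  fixes g h :: "real^'e"
  assumes Q: "is_Q_matrix Q" and a: "0 \<le> a" and b: "0 \<le> b"
  defines "k \<equiv> (\<chi> x. sqrt (a * (g $ x)\<^sup>2 + b * (h $ x)\<^sup>2))"
  shows "l2_inner \<pi> k k = a * l2_inner \<pi> g g + b * l2_inner \<pi> h h"
    and "l2_inner \<pi> (mult_op f k) k
      = a * l2_inner \<pi> (mult_op f g) g + b * l2_inner \<pi> (mult_op f h) h"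
    and "a * l2_inner \<pi> (Q *v g) g + b * l2_inner \<pi> (Q *v h) h \<le> l2_inner \<pi> (Q *v k) k"
proof -
  have kk: "k $ x * k $ x = a * (g $ x)\<^sup>2 + b * (h $ x)\<^sup>2" for x
    using a b by (simp add: k_def)
  show "l2_inner \<pi> k k = a * l2_inner \<pi> g g + b * l2_inner \<pi> h h"
    unfolding l2_inner_def kk
    by (simp add: power2_eq_square algebra_simps sum_distrib_left flip: sum.distrib)
  have "l2_inner \<pi> (mult_op f k) k = (\<Sum>x\<in>UNIV. f x * (k $ x * k $ x) * pmf \<pi> x)"
    by (simp add: l2_inner_mult_op mult.assoc)
  also have "\<dots> = a * l2_inner \<pi> (mult_op f g) g + b * l2_inner \<pi> (mult_op f h) h"
    unfolding l2_inner_mult_op kk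
    by (simp add: power2_eq_square algebra_simps sum_distrib_left flip: sum.distrib)
  finally show "l2_inner \<pi> (mult_op f k) k
      = a * l2_inner \<pi> (mult_op f g) g + b * l2_inner \<pi> (mult_op f h) h" .
  have off: "a * (g $ y * g $ x) + b * (h $ y * h $ x) \<le> k $ y * k $ x" for x y
  proof -
    have sq: "(sqrt c * p) * (sqrt c * q) = c * (p * q)" if "0 \<le> c" for c p q :: real
    proof -
      have "(sqrt c * p) * (sqrt c * q) = (sqrt c * sqrt c) * (p * q)"
        by (simp only: mult_ac)
      then show ?thesis using that by simp
    qed
    have "(sqrt a * g $ y) * (sqrt a * g $ x) + (sqrt b * h $ y) * (sqrt b * h $ x)
        = (sqrt a * g $ y, sqrt b * h $ y) \<bullet> (sqrt a * g $ x, sqrt b * h $ x)"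
      by simp
    also have "\<dots> \<le> norm (sqrt a * g $ y, sqrt b * h $ y) * norm (sqrt a * g $ x, sqrt b * h $ x)"
      by (rule norm_cauchy_schwarz)
    also have "\<dots> = k $ y * k $ x"
      using a b by (simp add: k_def norm_Pair power_mult_distrib)
    finally show ?thesis
      unfolding sq[OF a] sq[OF b] .
  qed
  have "a * l2_inner \<pi> (Q *v g) g + b * l2_inner \<pi> (Q *v h) h
      = (\<Sum>x\<in>UNIV. \<Sum>y\<in>UNIV. pmf \<pi> x * Q $ x $ y * (a * (g $ y * g $ x) + b * (h $ y * h $ x)))"
    unfolding l2_inner_matrix
    by (simp add: algebra_simps sum_distrib_left flip: sum.distrib)
  also have "\<dots> \<le> (\<Sum>x\<in>UNIV. \<Sum>y\<in>UNIV. pmf \<pi> x * Q $ x $ y * (k $ y * k $ x))"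
  proof (intro sum_mono)
    fix x y
    show "pmf \<pi> x * Q $ x $ y * (a * (g $ y * g $ x) + b * (h $ y * h $ x))
        \<le> pmf \<pi> x * Q $ x $ y * (k $ y * k $ x)"
    proof (cases "x = y")
      case True
      then show ?thesis by (simp add: kk power2_eq_square)
    next
      case False
      then have "0 \<le> pmf \<pi> x * Q $ x $ y"
        using Q by (simp add: is_Q_matrix_def)
      then show ?thesis
        using off by (rule mult_left_mono[rotated])
    qed
  qed
  also have "\<dots> = l2_inner \<pi> (Q *v k) k"
    unfolding l2_inner_matrix by (simp add: mult.assoc)
  finally show "a * l2_inner \<pi> (Q *v g) g + b * l2_inner \<pi> (Q *v h) h \<le> l2_inner \<pi> (Q *v k) k" .
qed

text \<open>
  The joint range of the two quadratic forms on the unit sphere, filled in upwards. The range itself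
  need not be convex, whereas this set is.
\<close>

definition energy_epigraph :: "real^'e^'e \<Rightarrow> ('e \<Rightarrow> real) \<Rightarrow> (real \<times> real) set" where
  "energy_epigraph Q f = {(u, v). \<exists>g. l2_norm \<pi> g = 1 \<and> l2_inner \<pi> (mult_op f g) g = u
      \<and> - l2_inner \<pi> (Q *v g) g \<le> v}"

lemma convex_energy_epigraph:
  assumes Q: "is_Q_matrix Q"
  shows "convex (energy_epigraph Q f)"
proof (rule convexI)
  fix p q :: "real \<times> real" and a b :: real
  assume p: "p \<in> energy_epigraph Q f" and q: "q \<in> energy_epigraph Q f"
    and ab: "0 \<le> a" "0 \<le> b" "a + b = 1"
  obtain g where g: "l2_norm \<pi> g = 1" "l2_inner \<pi> (mult_op f g) g = fst p"
    "- l2_inner \<pi> (Q *v g) g \<le> snd p"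
    using p by (auto simp: energy_epigraph_def)
  obtain h where h: "l2_norm \<pi> h = 1" "l2_inner \<pi> (mult_op f h) h = fst q"
    "- l2_inner \<pi> (Q *v h) h \<le> snd q"
    using q by (auto simp: energy_epigraph_def)
  let ?k = "(\<chi> x. sqrt (a * (g $ x)\<^sup>2 + b * (h $ x)\<^sup>2))"
  note k = energy_convex_in_squares[OF Q ab(1,2), where g = g and h = h]
  have "l2_norm \<pi> ?k = 1"
    using k(1) g(1) h(1) ab(3) by (simp add: l2_norm_eq_1_iff)
  moreover have "l2_inner \<pi> (mult_op f ?k) ?k = a * fst p + b * fst q"
    using k(2)[of f] g(2) h(2) by simp
  moreover have "- l2_inner \<pi> (Q *v ?k) ?k \<le> a * snd p + b * snd q"
    using k(3) mult_left_mono[OF g(3) ab(1)] mult_left_mono[OF h(3) ab(2)] by simp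
  ultimately show "a *\<^sub>R p + b *\<^sub>R q \<in> energy_epigraph Q f"
    unfolding energy_epigraph_def
    by (cases p, cases q) auto
qed

text \<open>The sum of a compact set and a closed vertical ray.\<close>

lemma closed_energy_epigraph: "closed (energy_epigraph Q f)"
proof -
  let ?F = "\<lambda>g. (l2_inner \<pi> (mult_op f g) g, - l2_inner \<pi> (Q *v g) g)"
  let ?S = "?F ` {g. l2_norm \<pi> g = 1}"
  let ?T = "{0} \<times> {0..} :: (real \<times> real) set"
  have "compact ?S"
    by (intro compact_continuous_image compact_l2_sphere continuous_intros
        linear_continuous_on linear_conv_bounded_linear[THEN iffD1] linear_mult_op
        matrix_vector_mul_linear)
  moreover have "closed ?T"
    by (intro closed_Times) auto
  ultimately have "closed (\<Union>x\<in>?S. \<Union>y\<in>?T. {x + y})"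
    by (rule compact_closed_sums)
  also have "(\<Union>x\<in>?S. \<Union>y\<in>?T. {x + y}) = energy_epigraph Q f"
  proof (intro equalityI subsetI)
    fix p assume "p \<in> (\<Union>x\<in>?S. \<Union>y\<in>?T. {x + y})"
    then show "p \<in> energy_epigraph Q f"
      by (auto simp: energy_epigraph_def)
  next
    fix p assume "p \<in> energy_epigraph Q f"
    then obtain g where g: "l2_norm \<pi> g = 1" "l2_inner \<pi> (mult_op f g) g = fst p"
      "- l2_inner \<pi> (Q *v g) g \<le> snd p"
      by (auto simp: energy_epigraph_def)
    have "?F g \<in> ?S" using g(1) by blast
    moreover have "(0, snd p + l2_inner \<pi> (Q *v g) g) \<in> ?T" using g(3) by auto
    moreover have "p = ?F g + (0, snd p + l2_inner \<pi> (Q *v g) g)"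
      using g(2) by (simp add: prod_eq_iff)
    ultimately show "p \<in> (\<Union>x\<in>?S. \<Union>y\<in>?T. {x + y})" by blast
  qed
  finally show ?thesis .
qed

text \<open>
  That the conjugate is at most the rate is immediate from the variational formula. For the converse,
  a real \<open>v\<close> below the infimum puts \<open>(u, v)\<close> outside the closed convex epigraph. A non-vertical
  separating line of slope \<open>r\<close> witnesses \<open>v < r u - \<lambda>\<^sub>0 r\<close>. A vertical one separates \<open>u\<close> from all values
  \<open>\<langle>f g, g\<rangle>\<close> on the unit sphere; as the energy is nonnegative, \<open>r u - \<lambda>\<^sub>0 r\<close> then grows at least linearly
  as \<open>r\<close> tends to infinity in a suitable direction.
\<close>

lemma fenchel_conjugate_lambda0_eq_rate:
  assumes Q: "is_Q_matrix Q" and inv: "invariant_distribution Q \<pi>"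
  shows "fenchel_conjugate (lambda0 \<pi> ((*v) Q) f) u = rate_I \<pi> ((*v) Q) f u"
proof (rule antisym)
  show "fenchel_conjugate (lambda0 \<pi> ((*v) Q) f) u \<le> rate_I \<pi> ((*v) Q) f u"
    unfolding fenchel_conjugate_def rate_I_def
  proof (intro SUP_least INF_greatest)
    fix r g assume "g \<in> {g. l2_norm \<pi> g = 1 \<and> l2_inner \<pi> (mult_op f g) g = u}"
    then show "ereal (r * u - lambda0 \<pi> ((*v) Q) f r) \<le> ereal (- l2_inner \<pi> (Q *v g) g)"
      using lambda0_variational(1)[of Q g r f] by (auto simp: l2_norm_eq_1_iff)
  qed
  show "rate_I \<pi> ((*v) Q) f u \<le> fenchel_conjugate (lambda0 \<pi> ((*v) Q) f) u"
  proof (rule ccontr)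
    assume "\<not> ?thesis"
    then obtain v where v1: "fenchel_conjugate (lambda0 \<pi> ((*v) Q) f) u < ereal v"
      and v2: "ereal v < rate_I \<pi> ((*v) Q) f u"
      using ereal_dense2 by (metis not_le)
    have conj: "r * u - lambda0 \<pi> ((*v) Q) f r < v" for r
    proof -
      have "ereal (r * u - lambda0 \<pi> ((*v) Q) f r) \<le> fenchel_conjugate (lambda0 \<pi> ((*v) Q) f) u"
        unfolding fenchel_conjugate_def by (rule SUP_upper) auto
      with v1 show ?thesis using le_less_trans by fastforce
    qed
    have "(u, v) \<notin> energy_epigraph Q f"
    proof
      assume "(u, v) \<in> energy_epigraph Q f"
      then obtain g where g: "l2_norm \<pi> g = 1" "l2_inner \<pi> (mult_op f g) g = u"
        "- l2_inner \<pi> (Q *v g) g \<le> v"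
        by (auto simp: energy_epigraph_def)
      then have "rate_I \<pi> ((*v) Q) f u \<le> ereal (- l2_inner \<pi> (Q *v g) g)"
        unfolding rate_I_def by (intro INF_lower) auto
      also have "\<dots> \<le> ereal v" using g(3) by simp
      finally show False using v2 by simp
    qed
    then obtain n d where sep: "n \<bullet> (u, v) < d" "\<And>p. p \<in> energy_epigraph Q f \<Longrightarrow> d < n \<bullet> p"
      using separating_hyperplane_closed_point[OF convex_energy_epigraph[OF Q] closed_energy_epigraph]
      by metis
    obtain a b where n: "n = (a, b)" by (cases n)
    define W where "W g = l2_inner \<pi> (mult_op f g) g" for g
    define J where "J g = - l2_inner \<pi> (Q *v g) g" for g
    have uv: "a * u + b * v < d"
      using sep(1) by (simp add: n)
    have sep': "d < a * W g + b * w" if "l2_norm \<pi> g = 1" "J g \<le> w" for g w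
      using sep(2)[of "(W g, w)"] that by (auto simp: energy_epigraph_def W_def J_def n)
    \<comment> \<open>The epigraph is unbounded upwards, so the normal cannot point downwards.\<close>
    have b: "0 \<le> b"
    proof (rule ccontr)
      assume nb: "\<not> 0 \<le> b"
      let ?g = "\<chi> x. 1"
      let ?w = "max (J ?g) ((d - a * W ?g) / b)"
      have "b * ?w \<le> b * ((d - a * W ?g) / b)"
        using nb by (intro mult_left_mono_neg) auto
      then show False
        using sep'[of ?g ?w] nb l2_norm_one[of \<pi>] by simp
    qed
    have lam: "\<exists>g. l2_norm \<pi> g = 1 \<and> lambda0 \<pi> ((*v) Q) f r = r * W g - J g" for r
      using lambda0_variational(2)[of Q r f] by (auto simp: W_def J_def algebra_simps)
    show False
    proof (cases "b = 0")
      case False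
      then have b: "0 < b" using b by simp
      obtain g where g: "l2_norm \<pi> g = 1"
        "lambda0 \<pi> ((*v) Q) f (- a / b) = (- a / b) * W g - J g"
        using lam by blast
      have "a * u + b * v < a * W g + b * J g"
        using uv sep'[OF g(1) order_refl] by simp
      then have "v < - (a / b) * u + (a / b) * W g + J g"
        using b by (simp add: field_simps)
      then show False
        using conj[of "- a / b"] g(2) by simp
    next
      case True
      define e where "e = d - a * u"
      have e: "0 < e" using uv True by (simp add: e_def)
      define m where "m = \<bar>v\<bar> / e"
      obtain g where g: "l2_norm \<pi> g = 1"
        "lambda0 \<pi> ((*v) Q) f (- a * m) = (- a * m) * W g - J g"
        using lam by blast
      have J: "0 \<le> J g"
        using generator_dissipative[OF Q inv, of g] by (simp add: J_def)
      have "e \<le> a * W g - a * u"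
        using sep'[OF g(1) order_refl] True by (simp add: e_def)
      then have "m * e \<le> m * (a * W g - a * u)"
        using e by (intro mult_left_mono) (auto simp: m_def)
      moreover have "m * e = \<bar>v\<bar>"
        using e by (simp add: m_def)
      ultimately show False
        using conj[of "- a * m"] g(2) J by (simp add: algebra_simps)
    qed
  qed
qed

end


section \<open>The matrix exponential\<close>

lemma matrix_power_entry_bound:
  fixes A :: "real^'n^'n"
  assumes "\<And>x y. \<bar>A $ x $ y\<bar> \<le> c"
  shows "\<bar>(((**) A ^^ n) (mat 1)) $ x $ y\<bar> \<le> (real CARD('n) * c) ^ n"
proof (induction n arbitrary: x y)
  case 0
  then show ?case by (simp add: mat_def)
next
  case (Suc n)
  let ?B = "((**) A ^^ n) (mat 1)"
  have "\<bar>(((**) A ^^ Suc n) (mat 1)) $ x $ y\<bar> = \<bar>\<Sum>z\<in>UNIV. A $ x $ z * ?B $ z $ y\<bar>"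
    by (simp add: matrix_matrix_mult_def)
  also have "\<dots> \<le> (\<Sum>z\<in>UNIV. \<bar>A $ x $ z * ?B $ z $ y\<bar>)"
    by (rule sum_abs)
  also have "\<dots> \<le> (\<Sum>z\<in>(UNIV::'n set). c * (real CARD('n) * c) ^ n)"
    unfolding abs_mult by (intro sum_mono mult_mono assms Suc.IH) (use assms[of x y] in auto)
  also have "\<dots> = (real CARD('n) * c) ^ Suc n"
    by simp
  finally show ?case .
qed

lemma matrix_power_scaleR:
  fixes A :: "real^'n^'n"
  shows "((**) (t *\<^sub>R A) ^^ n) (mat 1) = t ^ n *\<^sub>R ((**) A ^^ n) (mat 1)"
proof (induction n)
  case (Suc n)
  then show ?case
    by (simp add: vec_eq_iff matrix_matrix_mult_def sum_distrib_left mult_ac)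
qed simp

lemma matrix_exp_entry_summable:
  fixes A :: "real^'n^'n"
  shows "summable (\<lambda>n. (((**) A ^^ n) (mat 1)) $ x $ y / fact n * t ^ n)"
proof (rule summable_comparison_test')
  define c where "c = (\<Sum>x\<in>UNIV. \<Sum>y\<in>UNIV. \<bar>A $ x $ y\<bar>)"
  have c: "\<bar>A $ x $ y\<bar> \<le> c" for x y
  proof -
    have "\<bar>A $ x $ y\<bar> \<le> (\<Sum>y\<in>UNIV. \<bar>A $ x $ y\<bar>)"
      by (rule member_le_sum) auto
    also have "\<dots> \<le> c"
      unfolding c_def by (rule member_le_sum[of x UNIV "\<lambda>x. \<Sum>y\<in>UNIV. \<bar>A $ x $ y\<bar>"]) (auto intro: sum_nonneg)
    finally show ?thesis .
  qed
  show "summable (\<lambda>n. inverse (fact n) * (real CARD('n) * c * \<bar>t\<bar>) ^ n)"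
    by (rule summable_exp)
  show "norm ((((**) A ^^ n) (mat 1)) $ x $ y / fact n * t ^ n)
      \<le> inverse (fact n) * (real CARD('n) * c * \<bar>t\<bar>) ^ n" for n
  proof -
    have "\<bar>(((**) A ^^ n) (mat 1)) $ x $ y\<bar> * (inverse (fact n) * \<bar>t\<bar> ^ n)
        \<le> (real CARD('n) * c) ^ n * (inverse (fact n) * \<bar>t\<bar> ^ n)"
      by (intro mult_right_mono matrix_power_entry_bound c) auto
    then show ?thesis
      by (simp add: abs_mult power_abs power_mult_distrib field_simps)
  qed
qed

lemma matrix_exp_entry:
  fixes A :: "real^'n^'n"
  shows "matrix_exp (t *\<^sub>R A) $ x $ y = (\<Sum>n. (((**) A ^^ n) (mat 1)) $ x $ y / fact n * t ^ n)"
proof -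
  let ?s = "\<lambda>x y. \<Sum>n. (((**) A ^^ n) (mat 1)) $ x $ y / fact n * t ^ n"
  have "(\<lambda>n. (1 / fact n) *\<^sub>R (((**) (t *\<^sub>R A) ^^ n) (mat 1))) sums (\<chi> x y. ?s x y)"
    unfolding sums_def
  proof (intro vec_tendstoI)
    fix x y
    have "(\<lambda>n. (((**) A ^^ n) (mat 1)) $ x $ y / fact n * t ^ n) sums ?s x y"
      by (rule summable_sums[OF matrix_exp_entry_summable])
    then show "(\<lambda>k. (\<Sum>n<k. (1 / fact n) *\<^sub>R (((**) (t *\<^sub>R A) ^^ n) (mat 1))) $ x $ y)
        \<longlonglongrightarrow> (\<chi> x y. ?s x y) $ x $ y"
      by (simp add: sums_def matrix_power_scaleR sum_component mult_ac)
  qed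
  then have "matrix_exp (t *\<^sub>R A) = (\<chi> x y. ?s x y)"
    unfolding matrix_exp_def by (rule sums_unique[symmetric])
  then show ?thesis by simp
qed

lemma matrix_exp_0: "matrix_exp (0 *\<^sub>R A) $ x $ y = (mat 1 :: real^'n^'n) $ x $ y"
  unfolding matrix_exp_entry using powser_zero[of "\<lambda>n. (((**) A ^^ n) (mat 1)) $ x $ y / fact n"]
  by simp

lemma matrix_exp_has_derivative_at_0:
  fixes A :: "real^'n^'n"
  shows "((\<lambda>t. matrix_exp (t *\<^sub>R A) $ x $ y) has_real_derivative A $ x $ y) (at 0)"
proof -
  define c where "c n = (((**) A ^^ n) (mat 1)) $ x $ y / fact n" for n
  have "((\<lambda>t. \<Sum>n. c n * t ^ n) has_field_derivative (\<Sum>n. diffs c n * 0 ^ n)) (at 0)"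
    unfolding c_def by (rule termdiffs_strong_converges_everywhere) (rule matrix_exp_entry_summable)
  also have "(\<Sum>n. diffs c n * 0 ^ n) = A $ x $ y"
    unfolding powser_zero by (simp add: diffs_def c_def)
  finally show ?thesis
    by (simp add: matrix_exp_entry c_def)
qed

text \<open>
  Every term of the exponential series except the first is killed by a left null vector of \<open>A\<close>.
\<close>

lemma left_null_vector_matrix_exp:
  fixes A :: "real^'n^'n"
  assumes "w v* A = 0"
  shows "(\<Sum>x\<in>UNIV. w $ x * matrix_exp (t *\<^sub>R A) $ x $ y) = w $ y"
proof -
  let ?a = "\<lambda>n x. (((**) A ^^ n) (mat 1)) $ x $ y"
  have A: "(\<Sum>x\<in>UNIV. w $ x * A $ x $ z) = 0" for z
    using assms by (simp add: vec_eq_iff vector_matrix_mult_def mult.commute)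
  have kill: "(\<Sum>x\<in>UNIV. w $ x * ?a (Suc n) x) = 0" for n
  proof -
    have "(\<Sum>x\<in>UNIV. w $ x * ?a (Suc n) x) = (\<Sum>x\<in>UNIV. \<Sum>z\<in>UNIV. w $ x * A $ x $ z * ?a n z)"
      by (simp add: matrix_matrix_mult_def sum_distrib_left mult.assoc)
    also have "\<dots> = (\<Sum>z\<in>UNIV. \<Sum>x\<in>UNIV. w $ x * A $ x $ z * ?a n z)"
      by (rule sum.swap)
    also have "\<dots> = 0"
      by (simp add: A flip: sum_distrib_right)
    finally show ?thesis .
  qed
  have "(\<Sum>x\<in>UNIV. w $ x * matrix_exp (t *\<^sub>R A) $ x $ y)
      = (\<Sum>n. \<Sum>x\<in>UNIV. w $ x * (?a n x / fact n * t ^ n))"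
    unfolding matrix_exp_entry
    by (subst suminf_sum)
      (auto simp only: suminf_mult[OF matrix_exp_entry_summable]
        intro!: summable_mult matrix_exp_entry_summable)
  also have "\<dots> = (\<Sum>n. (\<Sum>x\<in>UNIV. w $ x * ?a n x) / fact n * t ^ n)"
    by (simp add: sum_distrib_left sum_distrib_right sum_divide_distrib mult_ac)
  also have "\<dots> = (\<Sum>n\<in>{0}. (\<Sum>x\<in>UNIV. w $ x * ?a n x) / fact n * t ^ n)"
  proof (rule suminf_finite)
    fix n :: nat assume "n \<notin> {0}"
    then obtain m where "n = Suc m" by (cases n) auto
    then show "(\<Sum>x\<in>UNIV. w $ x * ?a n x) / fact n * t ^ n = 0"
      using kill[of m] by simp
  qed auto
  also have "\<dots> = w $ y"
    by (simp add: mat_def if_distrib cong: if_cong)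
  finally show ?thesis .
qed

text \<open>
  The invariant distribution is preserved by \<open>exp Q\<close>, whose entries are transition probabilities
  and therefore positive.
\<close>

lemma invariant_distribution_pos:
  assumes irr: "irreducible_process P X" and Q: "has_Q_matrix P X Q"
    and inv: "invariant_distribution Q \<pi>"
  shows "0 < pmf \<pi> y"
proof -
  have p: "0 < matrix_exp (1 *\<^sub>R Q) $ x $ y" for x
    using irr Q unfolding irreducible_process_def has_Q_matrix_def
    by (metis zero_le_one zero_less_one)
  obtain x where x: "x \<in> set_pmf \<pi>" using set_pmf_not_empty[of \<pi>] by blast
  have "0 < (\<Sum>x\<in>UNIV. pmf \<pi> x * matrix_exp (1 *\<^sub>R Q) $ x $ y)"
    by (rule sum_pos2[of UNIV x]) (use p x in \<open>auto intro!: mult_pos_pos mult_nonneg_nonneg less_imp_le[OF p[simplified]] simp: pmf_positive\<close>)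
  also have "\<dots> = pmf \<pi> y"
    using left_null_vector_matrix_exp[of "\<chi> x. pmf \<pi> x" Q 1 y] inv
    by (simp add: invariant_distribution_def)
  finally show ?thesis .
qed


section \<open>Growth of products of nearly identical operators\<close>

context
  fixes \<pi> :: "'e::finite pmf"
  assumes pos: "\<And>x. 0 < pmf \<pi> x"
begin

lemma coordinate_products_bounded:
  obtains c where "0 < c" "\<And>g y z. \<bar>g $ y * g $ z\<bar> \<le> c * l2_inner \<pi> g (g::real^'e)"
proof
  define c where "c = (\<Sum>x\<in>UNIV. 1 / pmf \<pi> x)"
  show "0 < c"
    unfolding c_def using pos by (intro sum_pos) auto
  have sq: "(g $ y)\<^sup>2 \<le> c * l2_inner \<pi> g g" for g :: "real^'e" and y
  proof -
    have "(g $ y)\<^sup>2 * pmf \<pi> y \<le> l2_inner \<pi> g g"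
      unfolding l2_inner_def power2_eq_square
      by (rule member_le_sum[of y UNIV "\<lambda>x. g $ x * g $ x * pmf \<pi> x"]) auto
    then have "(g $ y)\<^sup>2 \<le> 1 / pmf \<pi> y * l2_inner \<pi> g g"
      using pos[of y] by (simp add: field_simps)
    also have "\<dots> \<le> c * l2_inner \<pi> g g"
      unfolding c_def
      by (intro mult_right_mono member_le_sum[of y UNIV "\<lambda>x. 1 / pmf \<pi> x"] l2_inner_self_nonneg) auto
    finally show ?thesis .
  qed
  show "\<bar>g $ y * g $ z\<bar> \<le> c * l2_inner \<pi> g g" for g :: "real^'e" and y z
    using sum_squares_bound[of "\<bar>g $ y\<bar>" "\<bar>g $ z\<bar>"] sq[of g y] sq[of g z]
    by (simp add: abs_mult)
qed

text \<open>
  The squared norm of \<open>S h g\<close> is a quadratic form in \<open>g\<close> whose coefficients have the same first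
  order expansion at \<open>h = 0\<close> as those of \<open>\<langle>g, g\<rangle> + 2 h \<langle>K g, g\<rangle>\<close>. Hence it is at most
  \<open>(1 + 2 h (l + \<epsilon>)) \<langle>g, g\<rangle>\<close> for small \<open>h > 0\<close>, uniformly in \<open>g\<close>.
\<close>

lemma norm_growth_near_identity:
  fixes S :: "real \<Rightarrow> real^'e^'e" and K :: "real^'e^'e"
  assumes S0: "S 0 = mat 1"
    and S': "\<And>x y. ((\<lambda>h. S h $ x $ y) has_real_derivative K $ x $ y) (at 0)"
    and K: "\<And>g. l2_inner \<pi> (K *v g) g \<le> l * l2_inner \<pi> g g"
    and e: "0 < e"
  shows "eventually (\<lambda>h. \<forall>g. l2_norm \<pi> (S h *v g) \<le> exp (h * (l + e)) * l2_norm \<pi> g) (at_right 0)"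
proof -
  obtain c where c: "0 < c" "\<And>g y z. \<bar>g $ y * g $ z\<bar> \<le> c * l2_inner \<pi> g (g::real^'e)"
    using coordinate_products_bounded by blast
  define N where "N = real CARD('e)"
  have N: "0 < N" by (simp add: N_def)
  \<comment> \<open>With errors below \<open>d h\<close> in all \<open>N\<^sup>2\<close> coefficients, the form changes by at most \<open>2 h e \<langle>g, g\<rangle>\<close>.\<close>
  define d where "d = 2 * e / (N * N * c)"
  have d: "0 < d" using e c N by (simp add: d_def)
  define D where "D h y z = (\<Sum>x\<in>UNIV. pmf \<pi> x * (S h $ x $ y * S h $ x $ z))" for h y z
  define D' where "D' y z = pmf \<pi> z * K $ z $ y + pmf \<pi> y * K $ y $ z" for y z
  have SD: "l2_inner \<pi> (S h *v g) (S h *v g)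
      = (\<Sum>y\<in>UNIV. \<Sum>z\<in>UNIV. D h y z * (g $ y * g $ z))" for h g
  proof -
    have "l2_inner \<pi> (S h *v g) (S h *v g)
        = (\<Sum>x\<in>UNIV. \<Sum>y\<in>UNIV. \<Sum>z\<in>UNIV. pmf \<pi> x * (S h $ x $ y * S h $ x $ z) * (g $ y * g $ z))"
      unfolding l2_inner_def
      by (simp add: matrix_vector_mult_def sum_product sum_distrib_left sum_distrib_right mult_ac)
    also have "\<dots> = (\<Sum>y\<in>UNIV. \<Sum>x\<in>UNIV. \<Sum>z\<in>UNIV. pmf \<pi> x * (S h $ x $ y * S h $ x $ z) * (g $ y * g $ z))"
      by (rule sum.swap)
    also have "\<dots> = (\<Sum>y\<in>UNIV. \<Sum>z\<in>UNIV. \<Sum>x\<in>UNIV. pmf \<pi> x * (S h $ x $ y * S h $ x $ z) * (g $ y * g $ z))"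
      by (intro sum.cong refl sum.swap)
    finally show ?thesis
      by (simp add: D_def sum_distrib_right)
  qed
  have D0: "(\<Sum>y\<in>UNIV. \<Sum>z\<in>UNIV. D 0 y z * (g $ y * g $ z)) = l2_inner \<pi> g g" for g
    unfolding SD[symmetric] S0 by simp
  have D'_form: "(\<Sum>y\<in>UNIV. \<Sum>z\<in>UNIV. D' y z * (g $ y * g $ z)) = 2 * l2_inner \<pi> (K *v g) g" for g
  proof -
    have "(\<Sum>y\<in>UNIV. \<Sum>z\<in>UNIV. D' y z * (g $ y * g $ z))
        = (\<Sum>y\<in>UNIV. \<Sum>z\<in>UNIV. pmf \<pi> z * K $ z $ y * g $ y * g $ z)
          + (\<Sum>y\<in>UNIV. \<Sum>z\<in>UNIV. pmf \<pi> y * K $ y $ z * g $ z * g $ y)"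
      by (simp add: D'_def algebra_simps flip: sum.distrib)
    also have "(\<Sum>y\<in>UNIV. \<Sum>z\<in>UNIV. pmf \<pi> z * K $ z $ y * g $ y * g $ z) = l2_inner \<pi> (K *v g) g"
      unfolding l2_inner_matrix by (rule sum.swap)
    finally show ?thesis by (simp add: l2_inner_matrix)
  qed
  have deriv: "((\<lambda>h. D h y z) has_real_derivative D' y z) (at 0)" for y z
  proof -
    have "((\<lambda>h. D h y z) has_real_derivative
        (\<Sum>x\<in>UNIV. pmf \<pi> x * (K $ x $ y * S 0 $ x $ z + K $ x $ z * S 0 $ x $ y))) (at 0)"
      (is "(_ has_real_derivative ?s) _")
      unfolding D_def by (intro DERIV_sum DERIV_cmult DERIV_mult S')
    also have "?s = (\<Sum>x\<in>UNIV. (pmf \<pi> x * K $ x $ y) * S 0 $ x $ z)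
        + (\<Sum>x\<in>UNIV. (pmf \<pi> x * K $ x $ z) * S 0 $ x $ y)"
      by (simp add: distrib_left sum.distrib mult.assoc)
    also have "\<dots> = D' y z"
      by (simp add: D'_def S0 mat_def if_distrib cong: if_cong)
    finally show ?thesis .
  qed
  have "eventually (\<lambda>h. D h y z - D 0 y z - h * D' y z < d * h \<and> - (d * h) < D h y z - D 0 y z - h * D' y z) (at_right 0)" for y z
  proof -
    have "((\<lambda>h. (D h y z - D 0 y z) / (h - 0)) \<longlongrightarrow> D' y z) (at_right 0)"
      using deriv[of y z] unfolding has_field_derivative_iff
      by (rule filterlim_mono[OF _ order_refl at_le]) auto
    then have "eventually (\<lambda>h. dist ((D h y z - D 0 y z) / (h - 0)) (D' y z) < d) (at_right 0)"
      using d by (rule tendstoD)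
    then show ?thesis
      using eventually_at_right_less[of 0]
    proof eventually_elim
      case (elim h)
      then have "\<bar>D h y z - D 0 y z - h * D' y z\<bar> < d * h"
        by (simp add: dist_real_def field_simps abs_less_iff)
      then show ?case by linarith
    qed
  qed
  then have "eventually (\<lambda>h. \<forall>y z. D h y z - D 0 y z - h * D' y z < d * h
      \<and> - (d * h) < D h y z - D 0 y z - h * D' y z) (at_right 0)"
    by (simp add: eventually_all_finite)
  then show ?thesis
    using eventually_at_right_less[of 0]
  proof eventually_elim
    case (elim h)
    show ?case
    proof
      fix g :: "real^'e"
      define G where "G = l2_inner \<pi> g g"
      have h: "0 < h" using elim by simp
      have "l2_inner \<pi> (S h *v g) (S h *v g) - G - h * (2 * l2_inner \<pi> (K *v g) g)
          = (\<Sum>y\<in>UNIV. \<Sum>z\<in>UNIV. (D h y z - D 0 y z - h * D' y z) * (g $ y * g $ z))"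
        unfolding SD[of h g] G_def D0[of g, symmetric] D'_form[of g, symmetric]
        by (simp add: left_diff_distrib sum_subtractf sum_distrib_left mult.assoc)
      also have "\<dots> \<le> (\<Sum>y\<in>(UNIV::'e set). \<Sum>z\<in>(UNIV::'e set). (d * h) * (c * G))"
      proof (intro sum_mono)
        fix y z
        have "\<bar>(D h y z - D 0 y z - h * D' y z) * (g $ y * g $ z)\<bar> \<le> (d * h) * (c * G)"
          unfolding abs_mult[of "D h y z - D 0 y z - h * D' y z"] G_def
          using elim(1)[rule_format, of y z] by (intro mult_mono c(2)) (use d h in auto)
        then show "(D h y z - D 0 y z - h * D' y z) * (g $ y * g $ z) \<le> (d * h) * (c * G)"
          by linarith
      qed
      also have "\<dots> = 2 * h * e * G"
        using c(1) N by (simp add: d_def flip: N_def)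
      finally have "l2_inner \<pi> (S h *v g) (S h *v g) \<le> G + h * (2 * l2_inner \<pi> (K *v g) g) + 2 * h * e * G"
        by linarith
      also have "\<dots> \<le> G + h * (2 * (l * G)) + 2 * h * e * G"
        using h K[of g] by (simp add: G_def)
      also have "\<dots> = (1 + 2 * h * (l + e)) * G"
        by (simp add: algebra_simps)
      also have "\<dots> \<le> exp (2 * h * (l + e)) * G"
        by (intro mult_right_mono exp_ge_add_one_self) (simp add: G_def l2_inner_self_nonneg)
      also have "\<dots> = (exp (h * (l + e)) * l2_norm \<pi> g)\<^sup>2"
        by (simp add: power_mult_distrib l2_norm_square G_def mult_ac flip: exp_double)
      finally show "l2_norm \<pi> (S h *v g) \<le> exp (h * (l + e)) * l2_norm \<pi> g"
        unfolding l2_norm_square[symmetric]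
        by (rule power2_le_imp_le) (simp add: l2_norm_nonneg)
    qed
  qed
qed

lemma l2_norm_iterate_le:
  assumes "\<And>g. l2_norm \<pi> (S *v g) \<le> a * l2_norm \<pi> g" and "0 \<le> a"
  shows "l2_norm \<pi> (((*v) S ^^ n) g) \<le> a ^ n * l2_norm \<pi> g"
proof (induction n)
  case (Suc n)
  have "l2_norm \<pi> (((*v) S ^^ Suc n) g) \<le> a * l2_norm \<pi> (((*v) S ^^ n) g)"
    using assms(1) by simp
  also have "\<dots> \<le> a * (a ^ n * l2_norm \<pi> g)"
    by (intro mult_left_mono Suc assms)
  finally show ?case by (simp add: mult.assoc)
qed simp

text \<open>
  Sampling at spacing \<open>t / n\<close>, the \<open>n\<close>-fold product grows at most like \<open>exp (t (l + \<epsilon>))\<close>: the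
  errors of the \<open>n\<close> factors add up to \<open>n (t / n) \<epsilon>\<close>.
\<close>

lemma norm_growth_products:
  fixes S :: "real \<Rightarrow> real^'e^'e" and K :: "real^'e^'e"
  assumes S0: "S 0 = mat 1"
    and S': "\<And>x y. ((\<lambda>h. S h $ x $ y) has_real_derivative K $ x $ y) (at 0)"
    and K: "\<And>g. l2_inner \<pi> (K *v g) g \<le> l * l2_inner \<pi> g g"
    and e: "0 < e" and t: "0 < t"
  shows "eventually (\<lambda>n. \<forall>g. l2_norm \<pi> (((*v) (S (t / real n)) ^^ n) g)
      \<le> exp (t * (l + e)) * l2_norm \<pi> g) sequentially"
proof -
  have "filterlim (\<lambda>n. t / real n) (at_right 0) sequentially"
    using t by real_asymp
  from eventually_compose_filterlim[OF norm_growth_near_identity[OF S0 S' K e] this]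
  show ?thesis
    using eventually_gt_at_top[of 0]
  proof eventually_elim
    case (elim n)
    have "exp (t / real n * (l + e)) ^ n = exp (t * (l + e))"
      using elim(2) by (simp flip: exp_of_nat_mult)
    then show ?case
      using l2_norm_iterate_le[of "S (t / real n)" "exp (t / real n * (l + e))" n] elim(1) by simp
  qed
qed

end


section \<open>Riemann sums of right-continuous functions\<close>

text \<open>
  The right-endpoint Riemann sum is the integral of \<open>s \<mapsto> \<phi> (s\<^sub>n)\<close>, where \<open>s\<^sub>n\<close> rounds \<open>s\<close> up to the
  grid of spacing \<open>t / n\<close>. Since \<open>s\<^sub>n\<close> tends to \<open>s\<close> from the right, right-continuity gives
  pointwise convergence, and dominated convergence does the rest.
\<close>

lemma riemann_sum_right_continuous:
  fixes \<phi> :: "real \<Rightarrow> real"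
  assumes t: "0 < t" and rc: "\<And>s. 0 \<le> s \<Longrightarrow> continuous (at_right s) \<phi>"
    and bound: "\<And>s. \<bar>\<phi> s\<bar> \<le> B"
  shows "(\<lambda>n. t / real n * (\<Sum>k=1..n. \<phi> (real k * (t / real n)))) \<longlonglongrightarrow> (LINT s:{0..t}|lborel. \<phi> s)"
proof -
  define g where "g n s = (\<Sum>k=1..n. \<phi> (real k * (t / real n)) *
      indicat_real {(real k - 1) * (t / real n)<..real k * (t / real n)} s)" for n s
  have g_eq: "g n s = (if 0 < s \<and> s \<le> t then \<phi> (of_int \<lceil>s / (t / real n)\<rceil> * (t / real n)) else 0)"
    if n: "0 < n" for n s
  proof -
    define h where "h = t / real n"
    have h: "0 < h" using t n by (simp add: h_def)
    have nh: "real n * h = t" using n by (simp add: h_def)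
    have cell: "s \<in> {(real k - 1) * h<..real k * h} \<longleftrightarrow> int k = \<lceil>s / h\<rceil>" for k
    proof -
      have "int k = \<lceil>s / h\<rceil> \<longleftrightarrow> real k - 1 < s / h \<and> s / h \<le> real k"
        using ceiling_eq_iff[of "s / h" "int k"] by auto
      then show ?thesis using h by (simp add: field_simps)
    qed
    show ?thesis
    proof (cases "0 < s \<and> s \<le> t")
      case True
      define k where "k = nat \<lceil>s / h\<rceil>"
      have "0 < s / h" "s / h \<le> real n"
        using True h nh by (auto simp: field_simps)
      then have k: "int k = \<lceil>s / h\<rceil>" "k \<in> {1..n}"
        unfolding k_def by (auto simp: ceiling_le_iff le_nat_iff nat_le_iff)
      have "g n s = (\<Sum>j=1..n. if j = k then \<phi> (real j * h) else 0)"
        unfolding g_def h_def[symmetric] indicator_def cell k(1)[symmetric]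
        by (intro sum.cong) auto
      also have "\<dots> = \<phi> (of_int \<lceil>s / h\<rceil> * h)"
        using k by (simp flip: k(1))
      finally show ?thesis using True by (simp add: h_def)
    next
      case False
      have "s \<notin> {(real k - 1) * h<..real k * h}" if "k \<in> {1..n}" for k
      proof
        assume s: "s \<in> {(real k - 1) * h<..real k * h}"
        have "0 \<le> (real k - 1) * h" "real k * h \<le> real n * h"
          using that h by auto
        then show False using s False nh by auto
      qed
      then show ?thesis
        using False by (auto simp: g_def h_def intro!: sum.neutral)
    qed
  qed
  have g_lim: "(\<lambda>n. g n s) \<longlonglongrightarrow> indicat_real {0<..t} s * \<phi> s" for s
  proof (cases "0 < s \<and> s \<le> t")
    case False
    have "eventually (\<lambda>n. g n s = 0) sequentially"
      using eventually_gt_at_top[of 0] by eventually_elim (use False g_eq in auto)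
    then show ?thesis
      using False by (auto intro: tendsto_eventually)
  next
    case True
    define y where "y n = of_int \<lceil>s / (t / real n)\<rceil> * (t / real n)" for n
    have y: "s \<le> y n \<and> y n \<le> s + t / real n" if n: "0 < n" for n
    proof -
      define h where "h = t / real n"
      have h: "0 < h" using t n by (simp add: h_def)
      have "s / h * h \<le> y n" "y n \<le> (s / h + 1) * h"
        unfolding y_def h_def[symmetric] using h by (intro mult_right_mono; linarith)+
      moreover have "s / h * h = s" "(s / h + 1) * h = s + h"
        using h by (simp_all add: distrib_right)
      ultimately show ?thesis unfolding h_def by linarith
    qed
    have y_lim: "y \<longlonglongrightarrow> s"
    proof (rule tendsto_sandwich)
      show "eventually (\<lambda>n. s \<le> y n) sequentially"
        using eventually_gt_at_top[of 0] by eventually_elim (use y in auto)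
      show "eventually (\<lambda>n. y n \<le> s + t / real n) sequentially"
        using eventually_gt_at_top[of 0] by eventually_elim (use y in auto)
      show "(\<lambda>n. s + t / real n) \<longlonglongrightarrow> s" by real_asymp
    qed auto
    have cont: "continuous (at s within {s..}) \<phi>"
      using rc[of s] True by (simp add: at_within_Ici_at_right)
    have "eventually (\<lambda>n. y n \<in> {s..}) sequentially"
      using eventually_gt_at_top[of 0] by eventually_elim (use y in auto)
    then have "(\<lambda>n. \<phi> (y n)) \<longlonglongrightarrow> \<phi> s"
      by (rule continuous_within_tendsto_compose[OF cont _ y_lim])
    moreover have "eventually (\<lambda>n. \<phi> (y n) = g n s) sequentially"
      using eventually_gt_at_top[of 0] by eventually_elim (use True in \<open>simp add: g_eq y_def\<close>)
    ultimately have "(\<lambda>n. g n s) \<longlonglongrightarrow> \<phi> s"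
      by (rule Lim_transform_eventually)
    then show ?thesis using True by simp
  qed
  have g_meas: "g n \<in> borel_measurable lborel" for n
    unfolding g_def by measurable
  have "(\<lambda>s. indicat_real {0<..t} s * \<phi> s) \<in> borel_measurable lborel"
    by (rule borel_measurable_LIMSEQ_real[OF g_lim g_meas])
  then have "(\<lambda>s. indicat_real {0<..t} s * \<phi> s + indicat_real {0} s * \<phi> 0) \<in> borel_measurable lborel"
    by measurable
  moreover have split: "indicat_real {0<..t} s * \<phi> s + indicat_real {0} s * \<phi> 0
      = indicat_real {0..t} s *\<^sub>R \<phi> s" for s
    using t by (auto simp: indicator_def)
  ultimately have meas: "(\<lambda>s. indicat_real {0..t} s *\<^sub>R \<phi> s) \<in> borel_measurable lborel"
    by simp
  have "(\<lambda>n. integral\<^sup>L lborel (g n)) \<longlonglongrightarrow> (LINT s|lborel. indicat_real {0..t} s *\<^sub>R \<phi> s)"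
  proof (rule integral_dominated_convergence[where w = "\<lambda>s. B * indicat_real {0..t} s"])
    show "AE s in lborel. (\<lambda>n. g n s) \<longlonglongrightarrow> indicat_real {0..t} s *\<^sub>R \<phi> s"
      using AE_lborel_singleton[of 0]
    proof eventually_elim
      case (elim s)
      then show ?case using g_lim[of s] split[of s] by auto
    qed
    show "AE s in lborel. norm (g n s) \<le> B * indicat_real {0..t} s" for n
    proof -
      have B: "0 \<le> B" using bound[of 0] by linarith
      show ?thesis
      proof (cases "n = 0")
        case True
        then show ?thesis using B by (simp add: g_def)
      next
        case False
        then show ?thesis using bound B by (auto simp: g_eq indicator_def)
      qed
    qed
    show "integrable lborel (\<lambda>s. B * indicat_real {0..t} s)"
      by (intro integrable_mult_right integrable_real_indicator) (use t in auto)
  qed (use g_meas meas in auto)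
  moreover have "eventually (\<lambda>n. integral\<^sup>L lborel (g n)
      = t / real n * (\<Sum>k=1..n. \<phi> (real k * (t / real n)))) sequentially"
    using eventually_gt_at_top[of 0]
  proof eventually_elim
    case (elim n)
    let ?I = "\<lambda>k. {(real k - 1) * (t / real n)<..real k * (t / real n)}"
    have mono: "(real k - 1) * (t / real n) \<le> real k * (t / real n)" for k
      using t elim by (intro mult_right_mono) auto
    have len: "measure lborel (?I k) = t / real n" for k
    proof -
      have "measure lborel (?I k) = real k * (t / real n) - (real k - 1) * (t / real n)"
        using mono[of k] by simp
      also have "\<dots> = t / real n"
        by (simp only: left_diff_distrib)
      finally show ?thesis .
    qed
    have int: "integrable lborel (\<lambda>s. \<phi> (real k * (t / real n)) * indicat_real (?I k) s)" for k
      by (intro integrable_mult_right integrable_real_indicator)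
        (simp_all only: emeasure_lborel_Ioc[OF mono] ennreal_less_top infinity_ennreal_def
          sets_lborel greaterThanAtMost_borel)
    have "integral\<^sup>L lborel (g n) = (\<Sum>k=1..n. \<phi> (real k * (t / real n)) * measure lborel (?I k))"
      unfolding g_def by (subst Bochner_Integration.integral_sum) (simp_all only: int, simp)
    then show ?case
      unfolding len by (simp add: sum_distrib_left mult.commute)
  qed
  ultimately show ?thesis
    unfolding set_lebesgue_integral_def by (rule Lim_transform_eventually)
qed


section \<open>Exponential moments of the additive functional\<close>

context markov_jump_process
begin

lemma space_P: "space (P x) = space M"
  using sets_P by (rule sets_eq_imp_space_eq)

lemma measurable_X_P: "0 \<le> t \<Longrightarrow> X t \<in> P x \<rightarrow>\<^sub>M count_space UNIV"
  using measurable_X measurable_cong_sets[OF sets_P refl] by blast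

lemma measurable_fun_X: "0 \<le> t \<Longrightarrow> (\<lambda>\<omega>. \<phi> (X t \<omega>)) \<in> borel_measurable (P x)"
  by (rule measurable_compose[OF measurable_X_P]) simp_all

lemma sets_natural_filtration:
  "sets (natural_filtration M X t) = sigma_sets (space M) {X s -` B \<inter> space M | s B. 0 \<le> s \<and> s \<le> t}"
  unfolding natural_filtration_def by (rule sets_measure_of) auto

lemma space_natural_filtration: "space (natural_filtration M X t) = space M"
  unfolding natural_filtration_def by (rule space_measure_of) auto

lemma measurable_fun_X_natural_filtration:
  assumes "0 \<le> s" "s \<le> t"
  shows "(\<lambda>\<omega>. \<phi> (X s \<omega>)) \<in> borel_measurable (natural_filtration M X t)"
proof (rule measurable_compose[of "X s" _ "count_space UNIV"])
  show "X s \<in> natural_filtration M X t \<rightarrow>\<^sub>M count_space UNIV"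
    by (rule measurableI)
      (use assms in \<open>auto simp: sets_natural_filtration space_natural_filtration intro!: sigma_sets.Basic\<close>)
qed simp

lemma finite_measure_subalgebra_natural_filtration:
  "finite_measure_subalgebra (P x) (natural_filtration M X t)"
proof -
  interpret prob_space "P x" by (rule prob_space_P)
  show ?thesis
  proof
    have "sigma_sets (space M) {X s -` B \<inter> space M | s B. 0 \<le> s \<and> s \<le> t} \<subseteq> sets M"
      by (rule sets.sigma_sets_subset) (auto intro!: measurable_sets[OF measurable_X])
    then show "subalgebra (P x) (natural_filtration M X t)"
      by (simp add: subalgebra_def sets_natural_filtration space_natural_filtration space_P sets_P)
  qed
qed

lemma integrable_path_product:
  fixes G \<phi> :: "'e \<Rightarrow> real"
  assumes h: "0 \<le> h"
  shows "integrable (P x) (\<lambda>\<omega>. (\<Prod>k=1..n. G (X (real k * h) \<omega>)) * \<phi> (X (real m * h) \<omega>))"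
proof -
  interpret prob_space "P x" by (rule prob_space_P)
  define B where "B = (\<Sum>y\<in>UNIV. \<bar>G y\<bar>)"
  have B: "\<bar>G y\<bar> \<le> B" for y
    unfolding B_def by (rule member_le_sum) auto
  have C: "\<bar>\<phi> y\<bar> \<le> (\<Sum>y\<in>UNIV. \<bar>\<phi> y\<bar>)" for y
    by (rule member_le_sum) auto
  show ?thesis
  proof (rule integrable_const_bound)
    show "AE \<omega> in P x. norm ((\<Prod>k=1..n. G (X (real k * h) \<omega>)) * \<phi> (X (real m * h) \<omega>))
        \<le> (\<Prod>k=1..n. B) * (\<Sum>y\<in>UNIV. \<bar>\<phi> y\<bar>)"
    proof (rule AE_I2)
      fix \<omega>
      have G: "\<bar>\<Prod>k=1..n. G (X (real k * h) \<omega>)\<bar> \<le> (\<Prod>k=1..n. B)"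
        unfolding abs_prod by (intro prod_mono conjI B abs_ge_zero)
      have B0: "0 \<le> (\<Prod>k=1..n. B)"
        by (intro prod_nonneg) (simp add: B_def sum_nonneg)
      show "norm ((\<Prod>k=1..n. G (X (real k * h) \<omega>)) * \<phi> (X (real m * h) \<omega>))
          \<le> (\<Prod>k=1..n. B) * (\<Sum>y\<in>UNIV. \<bar>\<phi> y\<bar>)"
        unfolding real_norm_def abs_mult by (rule mult_mono[OF G C B0 abs_ge_zero])
    qed
    show "(\<lambda>\<omega>. (\<Prod>k=1..n. G (X (real k * h) \<omega>)) * \<phi> (X (real m * h) \<omega>)) \<in> borel_measurable (P x)"
      by (intro borel_measurable_times borel_measurable_prod measurable_fun_X) (use h in auto)
  qed
qed

lemma expectation_initial:
  fixes \<phi> :: "'e \<Rightarrow> real"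
  shows "integral\<^sup>L (P x) (\<lambda>\<omega>. \<phi> (X 0 \<omega>)) = \<phi> x"
proof -
  interpret prob_space "P x" by (rule prob_space_P)
  have "{\<omega> \<in> space (P x). X 0 \<omega> = x} \<in> sets (P x)"
    using measurable_sets[OF measurable_X_P[of 0 x], of "{x}"] by (simp add: vimage_def Int_def conj_commute)
  then have "AE \<omega> in P x. X 0 \<omega> = x"
    using initial[of x] by (subst prob_Collect_eq_1[symmetric]) auto
  then have "integral\<^sup>L (P x) (\<lambda>\<omega>. \<phi> (X 0 \<omega>)) = integral\<^sup>L (P x) (\<lambda>\<omega>. \<phi> x)"
    by (intro integral_cong_AE) (auto intro: measurable_fun_X)
  then show ?thesis by (simp add: prob_space)
qed

text \<open>
  Conditioning on the last but one sampling time replaces \<open>G \<phi>\<close> at the final time by the one-step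
  operator applied to \<open>\<phi>\<close> at the time before.
\<close>

lemma expectation_path_product:
  fixes G \<phi> :: "'e \<Rightarrow> real"
  assumes h: "0 \<le> h"
  defines "S \<equiv> (\<chi> x y. transition_function P X h x y * G y) :: real^'e^'e"
  shows "integral\<^sup>L (P x) (\<lambda>\<omega>. (\<Prod>k=1..n. G (X (real k * h) \<omega>)) * \<phi> (X (real n * h) \<omega>))
    = (((*v) S ^^ n) (\<chi> y. \<phi> y)) $ x"
proof (induction n arbitrary: \<phi>)
  case 0
  then show ?case using expectation_initial[of x \<phi>] by simp
next
  case (Suc n)
  define F where "F \<omega> = (\<Prod>k=1..n. G (X (real k * h) \<omega>))" for \<omega>
  define s where "s = real n * h"
  have s: "0 \<le> s" using h by (simp add: s_def)
  have Suc_h: "real (Suc n) * h = s + h" by (simp add: s_def distrib_right)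
  interpret finite_measure_subalgebra "P x" "natural_filtration M X s"
    by (rule finite_measure_subalgebra_natural_filtration)
  let ?p = "transition_function P X h"
  have F: "F \<in> borel_measurable (natural_filtration M X s)"
    unfolding F_def
    by (intro borel_measurable_prod measurable_fun_X_natural_filtration)
      (use h in \<open>auto simp: s_def intro: mult_right_mono\<close>)
  have intF: "integrable (P x) (\<lambda>\<omega>. F \<omega> * \<psi> (X (real m * h) \<omega>))" for \<psi> m
    unfolding F_def by (rule integrable_path_product[OF h])
  have step: "(LINT \<omega>|P x. F \<omega> * indicat_real {y} (X (s + h) \<omega>)) = (LINT \<omega>|P x. F \<omega> * ?p (X s \<omega>) y)"
    for y
  proof -
    have X: "(\<lambda>\<omega>. indicat_real {y} (X (s + h) \<omega>)) \<in> borel_measurable (P x)"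
      using s h by (intro measurable_fun_X) simp
    have int: "integrable (P x) (\<lambda>\<omega>. F \<omega> * indicat_real {y} (X (s + h) \<omega>))"
      using intF[of "indicat_real {y}" "Suc n"] by (simp only: Suc_h)
    have "(LINT \<omega>|P x. F \<omega> * indicat_real {y} (X (s + h) \<omega>))
        = (LINT \<omega>|P x. F \<omega> * real_cond_exp (P x) (natural_filtration M X s)
            (\<lambda>\<omega>. indicat_real {y} (X (s + h) \<omega>)) \<omega>)"
      by (rule real_cond_exp_intg(2)[OF int F X, symmetric])
    also have "\<dots> = (LINT \<omega>|P x. F \<omega> * ?p (X s \<omega>) y)"
    proof (rule integral_cong_AE)
      show "AE \<omega> in P x. F \<omega> * real_cond_exp (P x) (natural_filtration M X s)
          (\<lambda>\<omega>. indicat_real {y} (X (s + h) \<omega>)) \<omega> = F \<omega> * ?p (X s \<omega>) y"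
        using markov_property[OF s h, of x y] by eventually_elim simp
      show "(\<lambda>\<omega>. F \<omega> * real_cond_exp (P x) (natural_filtration M X s)
          (\<lambda>\<omega>. indicat_real {y} (X (s + h) \<omega>)) \<omega>) \<in> borel_measurable (P x)"
        using real_cond_exp_intg(1)[OF int F X] by (rule borel_measurable_integrable)
      show "(\<lambda>\<omega>. F \<omega> * ?p (X s \<omega>) y) \<in> borel_measurable (P x)"
        using intF[of "\<lambda>z. ?p z y" n] by (simp add: s_def borel_measurable_integrable)
    qed
    finally show ?thesis .
  qed
  have expand: "\<psi> z = (\<Sum>y\<in>UNIV. \<psi> y * indicat_real {y} z)" for \<psi> :: "'e \<Rightarrow> real" and z
    by (simp add: indicator_def if_distrib cong: if_cong)
  have "(\<lambda>\<omega>. (\<Prod>k=1..Suc n. G (X (real k * h) \<omega>)) * \<phi> (X (real (Suc n) * h) \<omega>))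
      = (\<lambda>\<omega>. \<Sum>y\<in>UNIV. (G y * \<phi> y) * (F \<omega> * indicat_real {y} (X (s + h) \<omega>)))"
  proof
    fix \<omega>
    have "(\<Prod>k=1..Suc n. G (X (real k * h) \<omega>)) * \<phi> (X (real (Suc n) * h) \<omega>)
        = F \<omega> * (G (X (s + h) \<omega>) * \<phi> (X (s + h) \<omega>))"
      by (simp add: F_def Suc_h del: of_nat_Suc)
    also have "G (X (s + h) \<omega>) * \<phi> (X (s + h) \<omega>)
        = (\<Sum>y\<in>UNIV. (G y * \<phi> y) * indicat_real {y} (X (s + h) \<omega>))"
      by (rule expand[of "\<lambda>y. G y * \<phi> y"])
    finally show "(\<Prod>k=1..Suc n. G (X (real k * h) \<omega>)) * \<phi> (X (real (Suc n) * h) \<omega>)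
        = (\<Sum>y\<in>UNIV. (G y * \<phi> y) * (F \<omega> * indicat_real {y} (X (s + h) \<omega>)))"
      by (simp only: sum_distrib_left mult_ac)
  qed
  then have "(LINT \<omega>|P x. (\<Prod>k=1..Suc n. G (X (real k * h) \<omega>)) * \<phi> (X (real (Suc n) * h) \<omega>))
      = (LINT \<omega>|P x. (\<Sum>y\<in>UNIV. (G y * \<phi> y) * (F \<omega> * indicat_real {y} (X (s + h) \<omega>))))"
    by simp
  also have "\<dots> = (\<Sum>y\<in>UNIV. (G y * \<phi> y) * (LINT \<omega>|P x. F \<omega> * indicat_real {y} (X (s + h) \<omega>)))"
    using intF[of "indicat_real {y}" "Suc n" for y]
    by (subst Bochner_Integration.integral_sum) (simp_all only: Suc_h integrable_mult_right integral_mult_right_zero)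
  also have "\<dots> = (\<Sum>y\<in>UNIV. (G y * \<phi> y) * (LINT \<omega>|P x. F \<omega> * ?p (X s \<omega>) y))"
    by (simp only: step)
  also have "\<dots> = (LINT \<omega>|P x. (\<Sum>y\<in>UNIV. (G y * \<phi> y) * (F \<omega> * ?p (X s \<omega>) y)))"
    using intF[of "\<lambda>z. ?p z y" n for y]
    by (subst Bochner_Integration.integral_sum) (simp_all only: s_def integrable_mult_right integral_mult_right_zero)
  also have "\<dots> = (LINT \<omega>|P x. F \<omega> * (S *v (\<chi> y. \<phi> y)) $ X s \<omega>)"
    by (simp add: S_def matrix_vector_mult_def sum_distrib_left mult_ac)
  also have "\<dots> = (((*v) S ^^ n) (\<chi> y. (S *v (\<chi> y. \<phi> y)) $ y)) $ x"
    using Suc.IH[of "\<lambda>y. (S *v (\<chi> y. \<phi> y)) $ y"] by (simp add: F_def s_def)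
  also have "\<dots> = (((*v) S ^^ Suc n) (\<chi> y. \<phi> y)) $ x"
    by (simp only: vec_nth_inverse vec_lambda_eta funpow_Suc_right o_apply)
  finally show ?case .
qed

lemma riemann_sum_additive_functional:
  assumes \<omega>: "\<omega> \<in> space M" and t: "0 < t"
  shows "(\<lambda>n. t / real n * (\<Sum>k=1..n. f (X (real k * (t / real n)) \<omega>)))
    \<longlonglongrightarrow> additive_functional X f t \<omega>"
  unfolding additive_functional_def
proof (rule riemann_sum_right_continuous[OF t])
  show "continuous (at_right s) (\<lambda>s. f (X s \<omega>))" if "0 \<le> s" for s
    unfolding continuous_within
    using right_continuous_paths[OF \<omega> that] by (auto intro!: tendsto_eventually elim: eventually_mono)
  show "\<bar>f (X s \<omega>)\<bar> \<le> (\<Sum>y\<in>UNIV. \<bar>f y\<bar>)" for s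
    by (rule member_le_sum) auto
qed

text \<open>
  The exponential of a Riemann sum is a product over the sampling times, so its expectation is an
  entry of a matrix power; the Riemann sums are uniformly bounded, which permits passing to the limit.
\<close>

lemma exp_moment_limit:
  fixes f :: "'e \<Rightarrow> real" and r :: real
  assumes t: "0 < t"
  defines "S \<equiv> (\<lambda>h. (\<chi> x y. transition_function P X h x y * exp (h * r * f y)) :: real^'e^'e)"
  shows "(\<lambda>n. (((*v) (S (t / real n)) ^^ n) (\<chi> y. 1)) $ x)
      \<longlonglongrightarrow> (LINT \<omega>|P x. exp (r * additive_functional X f t \<omega>))"
    and "integrable (P x) (\<lambda>\<omega>. exp (r * additive_functional X f t \<omega>))"
    and "additive_functional X f t \<in> borel_measurable (P x)"
proof -
  interpret prob_space "P x" by (rule prob_space_P)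
  define R where "R n \<omega> = t / real n * (\<Sum>k=1..n. f (X (real k * (t / real n)) \<omega>))" for n \<omega>
  define B where "B = (\<Sum>y\<in>UNIV. \<bar>f y\<bar>)"
  have B: "\<bar>f y\<bar> \<le> B" for y
    unfolding B_def by (rule member_le_sum) auto
  have lim: "(\<lambda>n. R n \<omega>) \<longlonglongrightarrow> additive_functional X f t \<omega>" if "\<omega> \<in> space (P x)" for \<omega>
    using riemann_sum_additive_functional[of \<omega> t f] that t by (simp add: R_def space_P)
  have R: "R n \<in> borel_measurable (P x)" for n
    unfolding R_def by (intro borel_measurable_times borel_measurable_sum measurable_fun_X) (use t in auto)
  show A: "additive_functional X f t \<in> borel_measurable (P x)"
    by (rule borel_measurable_LIMSEQ_real[OF lim R])
  have R_bound: "\<bar>R n \<omega>\<bar> \<le> t * B" for n \<omega>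
  proof (cases "n = 0")
    case True
    then show ?thesis using t by (simp add: R_def B_def sum_nonneg)
  next
    case False
    have "\<bar>\<Sum>k=1..n. f (X (real k * (t / real n)) \<omega>)\<bar> \<le> (\<Sum>k=1..n. B)"
      by (rule order_trans[OF sum_abs sum_mono]) (rule B)
    then have "\<bar>R n \<omega>\<bar> \<le> t / real n * (real n * B)"
      unfolding R_def abs_mult using t by (intro mult_mono) auto
    then show ?thesis using False by simp
  qed
  have exp_bound: "exp (r * z) \<le> exp (\<bar>r\<bar> * (t * B))" if "\<bar>z\<bar> \<le> t * B" for z
  proof -
    have "r * z \<le> \<bar>r\<bar> * \<bar>z\<bar>" by (metis abs_ge_self abs_mult)
    also have "\<dots> \<le> \<bar>r\<bar> * (t * B)" using that by (intro mult_left_mono) auto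
    finally show ?thesis by simp
  qed
  have exp_lim: "AE \<omega> in P x. (\<lambda>n. exp (r * R n \<omega>)) \<longlonglongrightarrow> exp (r * additive_functional X f t \<omega>)"
    by (intro AE_I2 tendsto_intros lim)
  have meas: "(\<lambda>\<omega>. exp (r * additive_functional X f t \<omega>)) \<in> borel_measurable (P x)"
    "\<And>n. (\<lambda>\<omega>. exp (r * R n \<omega>)) \<in> borel_measurable (P x)"
    using A R by measurable
  note dom = integral_dominated_convergence[OF meas integrable_const[of "exp (\<bar>r\<bar> * (t * B))"] exp_lim]
    integrable_dominated_convergence[OF meas integrable_const[of "exp (\<bar>r\<bar> * (t * B))"] exp_lim]
  show "integrable (P x) (\<lambda>\<omega>. exp (r * additive_functional X f t \<omega>))"
    by (rule dom(2)) (intro AE_I2, simp only: real_norm_def abs_exp_cancel exp_bound R_bound)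
  have "(\<lambda>n. LINT \<omega>|P x. exp (r * R n \<omega>)) \<longlonglongrightarrow> (LINT \<omega>|P x. exp (r * additive_functional X f t \<omega>))"
    by (rule dom(1)) (intro AE_I2, simp only: real_norm_def abs_exp_cancel exp_bound R_bound)
  moreover have "(LINT \<omega>|P x. exp (r * R n \<omega>)) = (((*v) (S (t / real n)) ^^ n) (\<chi> y. 1)) $ x" for n
  proof -
    have "exp (r * R n \<omega>) = (\<Prod>k=1..n. exp (t / real n * r * f (X (real k * (t / real n)) \<omega>))) * 1" for \<omega>
      by (simp add: R_def exp_sum[symmetric] sum_distrib_left mult_ac)
    then show ?thesis
      using expectation_path_product[of "t / real n" x "\<lambda>y. exp (t / real n * r * f y)" n "\<lambda>y. 1"] t
      by (simp add: S_def)
  qed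
  ultimately show "(\<lambda>n. (((*v) (S (t / real n)) ^^ n) (\<chi> y. 1)) $ x)
      \<longlonglongrightarrow> (LINT \<omega>|P x. exp (r * additive_functional X f t \<omega>))"
    by simp
qed

end

text \<open>
  The one-step matrix has derivative \<open>K = Q + r M\<^sub>f\<close> at step size \<open>0\<close>, and its \<open>n\<close>-fold product is
  paired with the density of \<open>\<nu>\<close>. The bound holds with \<open>\<lambda>\<^sub>0 r + e\<close> for every \<open>e > 0\<close>.
\<close>

lemma exp_moment_bound:
  fixes M :: "'w measure" and P :: "'e::finite \<Rightarrow> 'w measure" and f :: "'e \<Rightarrow> real"
  assumes mjp: "markov_jump_process M P X" and Q: "has_Q_matrix P X Q"
    and pos: "\<And>x. 0 < pmf \<pi> x" and t: "0 < t"
  shows "(\<Sum>x\<in>UNIV. pmf \<nu> x * (LINT \<omega>|P x. exp (r * additive_functional X f t \<omega>)))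
    \<le> l2_norm \<pi> (rn_density \<nu> \<pi>) * exp (t * lambda0 \<pi> ((*v) Q) f r)"
proof -
  interpret markov_jump_process M P X by (rule mjp)
  define l where "l = lambda0 \<pi> ((*v) Q) f r"
  define S where "S h = (\<chi> x y. matrix_exp (h *\<^sub>R Q) $ x $ y * exp (h * r * f y))" for h
  define K where "K = Q + (\<chi> x y. if x = y then r * f y else 0)"
  define C where "C = l2_norm \<pi> (rn_density \<nu> \<pi>)"
  have S_eq: "S h = (\<chi> x y. transition_function P X h x y * exp (h * r * f y))" if "0 \<le> h" for h
    using Q that by (simp add: S_def has_Q_matrix_def)
  have S0: "S 0 = mat 1"
    by (simp only: S_def matrix_exp_0) (simp add: vec_eq_iff)
  have S': "((\<lambda>h. S h $ x $ y) has_real_derivative K $ x $ y) (at 0)" for x y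
  proof -
    have "((\<lambda>h. matrix_exp (h *\<^sub>R Q) $ x $ y * exp (h * r * f y)) has_real_derivative
        Q $ x $ y * exp (0 * r * f y) + (r * f y * exp (0 * r * f y)) * matrix_exp (0 *\<^sub>R Q) $ x $ y) (at 0)"
      by (intro DERIV_mult matrix_exp_has_derivative_at_0) (auto intro!: derivative_eq_intros)
    also have "Q $ x $ y * exp (0 * r * f y) + (r * f y * exp (0 * r * f y)) * matrix_exp (0 *\<^sub>R Q) $ x $ y
        = K $ x $ y"
      by (simp only: matrix_exp_0) (simp add: K_def mat_def)
    finally show ?thesis
      by (simp add: S_def)
  qed
  have K: "l2_inner \<pi> (K *v g) g \<le> l * l2_inner \<pi> g g" for g
  proof -
    have "K *v g = Q *v g + r *\<^sub>R mult_op f g"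
      by (simp add: K_def matrix_vector_mult_def mult_op_def vec_eq_iff distrib_right sum.distrib
          if_distrib[of "\<lambda>a. a * _"] mult.assoc cong: if_cong)
    then show ?thesis
      using lambda0_variational(1)[OF pos, of Q g r f] by (simp add: l_def l2_inner_linear)
  qed
  have lim: "(\<lambda>n. \<Sum>x\<in>UNIV. pmf \<nu> x * (((*v) (S (t / real n)) ^^ n) (\<chi> y. 1)) $ x)
      \<longlonglongrightarrow> (\<Sum>x\<in>UNIV. pmf \<nu> x * (LINT \<omega>|P x. exp (r * additive_functional X f t \<omega>)))"
    using exp_moment_limit(1)[OF t, of r f] t
    by (intro tendsto_intros) (simp add: S_eq)
  have pair: "(\<Sum>x\<in>UNIV. pmf \<nu> x * v $ x) \<le> C * l2_norm \<pi> v" for v :: "real^'e"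
  proof -
    have "(\<Sum>x\<in>UNIV. pmf \<nu> x * v $ x) = l2_inner \<pi> (rn_density \<nu> \<pi>) v"
      using pos by (simp add: l2_inner_def rn_density_def less_imp_neq[THEN not_sym])
    then show ?thesis
      using l2_cauchy_schwarz[of \<pi> "rn_density \<nu> \<pi>" v] by (simp add: C_def)
  qed
  have C: "0 \<le> C" by (simp add: C_def l2_norm_nonneg)
  have eps: "(\<Sum>x\<in>UNIV. pmf \<nu> x * (LINT \<omega>|P x. exp (r * additive_functional X f t \<omega>)))
      \<le> C * exp (t * (l + e))" if "0 < e" for e
  proof (rule tendsto_upperbound[OF lim])
    show "eventually (\<lambda>n. (\<Sum>x\<in>UNIV. pmf \<nu> x * (((*v) (S (t / real n)) ^^ n) (\<chi> y. 1)) $ x)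
        \<le> C * exp (t * (l + e))) sequentially"
      using norm_growth_products[OF pos S0 S' K \<open>0 < e\<close> t]
    proof eventually_elim
      case (elim n)
      have "l2_norm \<pi> (((*v) (S (t / real n)) ^^ n) (\<chi> y. 1)) \<le> exp (t * (l + e))"
        using elim[rule_format, of "\<chi> y. 1"] by (simp add: l2_norm_one)
      then show ?case
        using pair[of "((*v) (S (t / real n)) ^^ n) (\<chi> y. 1)"] C
        by (meson mult_left_mono order_trans)
    qed
  qed simp
  have "((\<lambda>e. C * exp (t * (l + e))) \<longlongrightarrow> C * exp (t * (l + 0))) (at_right 0)"
    by (intro tendsto_intros)
  then have "(\<Sum>x\<in>UNIV. pmf \<nu> x * (LINT \<omega>|P x. exp (r * additive_functional X f t \<omega>)))
      \<le> C * exp (t * (l + 0))"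
    by (rule tendsto_lowerbound) (auto intro!: eventually_at_rightI[of 0 1] eps)
  then show ?thesis by (simp add: C_def l_def)
qed


section \<open>The deviation inequality\<close>

lemma chernoff_bound:
  fixes M :: "'w measure" and P :: "'e::finite \<Rightarrow> 'w measure" and f :: "'e \<Rightarrow> real"
  assumes mjp: "markov_jump_process M P X" and Q: "has_Q_matrix P X Q"
    and pos: "\<And>x. 0 < pmf \<pi> x" and t: "0 < t" and r: "0 \<le> r"
  shows "mixture_prob \<nu> P {\<omega> \<in> space M. u \<le> additive_functional X f t \<omega> / t}
    \<le> l2_norm \<pi> (rn_density \<nu> \<pi>) * exp (- (t * (r * u - lambda0 \<pi> ((*v) Q) f r)))"
proof -
  interpret markov_jump_process M P X by (rule mjp)
  define E where "E x = (LINT \<omega>|P x. exp (r * additive_functional X f t \<omega>))" for x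
  have tail: "measure (P x) {\<omega> \<in> space M. u \<le> additive_functional X f t \<omega> / t}
      \<le> exp (- (t * (r * u))) * E x" for x
  proof -
    interpret prob_space "P x" by (rule prob_space_P)
    have [measurable]: "additive_functional X f t \<in> borel_measurable (P x)"
      by (rule exp_moment_limit(3)[OF t])
    have event: "{\<omega> \<in> space (P x). exp (r * (t * u)) \<le> exp (r * additive_functional X f t \<omega>)}
        \<in> sets (P x)"
      by measurable
    have "measure (P x) {\<omega> \<in> space M. u \<le> additive_functional X f t \<omega> / t}
        \<le> measure (P x) {\<omega> \<in> space (P x). exp (r * (t * u)) \<le> exp (r * additive_functional X f t \<omega>)}"
      by (rule finite_measure_mono[OF _ event])
        (use t r in \<open>auto simp: space_P pos_le_divide_eq mult.commute intro!: mult_left_mono\<close>)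
    also have "\<dots> \<le> E x / exp (r * (t * u))"
      unfolding E_def
      by (rule integral_Markov_inequality_measure[OF exp_moment_limit(2)[OF t], where A = "{}"]) auto
    also have "\<dots> = exp (- (t * (r * u))) * E x"
      by (simp add: exp_minus field_simps)
    finally show ?thesis .
  qed
  have "mixture_prob \<nu> P {\<omega> \<in> space M. u \<le> additive_functional X f t \<omega> / t}
      \<le> (\<Sum>x\<in>UNIV. pmf \<nu> x * (exp (- (t * (r * u))) * E x))"
    unfolding mixture_prob_def by (intro sum_mono mult_left_mono tail) simp
  also have "\<dots> = exp (- (t * (r * u))) * (\<Sum>x\<in>UNIV. pmf \<nu> x * E x)"
    by (simp add: sum_distrib_left mult_ac)
  also have "\<dots> \<le> exp (- (t * (r * u)))
      * (l2_norm \<pi> (rn_density \<nu> \<pi>) * exp (t * lambda0 \<pi> ((*v) Q) f r))"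
    unfolding E_def by (intro mult_left_mono exp_moment_bound[OF mjp Q pos t]) simp
  also have "\<dots> = l2_norm \<pi> (rn_density \<nu> \<pi>) * exp (- (t * (r * u - lambda0 \<pi> ((*v) Q) f r)))"
    by (simp add: algebra_simps flip: exp_add)
  finally show ?thesis .
qed

text \<open>
  Optimising over \<open>r\<close> in extended arithmetic: if the supremum is infinite, the bounds for single
  \<open>r\<close> force \<open>p = 0\<close>.
\<close>

lemma le_exp_SUP:
  fixes p C t :: real and a :: "'a \<Rightarrow> real"
  assumes C: "0 \<le> C" and t: "0 < t" and "I \<noteq> {}"
    and le: "\<And>r. r \<in> I \<Longrightarrow> p \<le> C * exp (- (t * a r))"
  shows "ereal p \<le> ereal C * exp_ereal (- (ereal t * (SUP r\<in>I. ereal (a r))))"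
proof (cases "p \<le> 0")
  case True
  have "0 \<le> ereal C * exp_ereal b" for b
    using C by (intro ereal_0_le_mult) (auto simp: exp_ereal_def)
  moreover have "ereal p \<le> 0" using True by (simp flip: zero_ereal_def)
  ultimately show ?thesis by (rule order_trans[rotated])
next
  case False
  then have p: "0 < p" by simp
  obtain r0 where r0: "r0 \<in> I" using \<open>I \<noteq> {}\<close> by blast
  have C: "0 < C" using le[OF r0] p C by (cases "C = 0") auto
  \<comment> \<open>The exponent for which the bound would be an equality; no \<open>a r\<close> exceeds it.\<close>
  define m where "m = - ln (p / C) / t"
  have am: "a r \<le> m" if "r \<in> I" for r
  proof -
    have "p / C \<le> exp (- (t * a r))"
      using le[OF that] C by (simp add: field_simps)
    then have "ln (p / C) \<le> - (t * a r)"
      using p C by (metis divide_pos_pos ln_exp ln_le_cancel_iff exp_gt_zero)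
    then show ?thesis
      using t by (simp add: m_def field_simps)
  qed
  define s where "s = (SUP r\<in>I. ereal (a r))"
  have "s \<le> ereal m"
    unfolding s_def by (rule SUP_least) (simp add: am)
  moreover have "ereal (a r0) \<le> s"
    unfolding s_def by (rule SUP_upper[OF r0])
  ultimately obtain q where q: "s = ereal q" "q \<le> m"
    by (cases s) auto
  have "p = C * exp (- (t * m))"
    using p C t by (simp add: m_def)
  also have "\<dots> \<le> C * exp (- (t * q))"
    using C t q(2) by simp
  finally show ?thesis
    by (simp add: exp_ereal_def q(1) flip: s_def)
qed

theorem theorem3p3p7:
  fixes M :: "'w measure"
    and P :: "'e::finite \<Rightarrow> 'w measure"
    and X :: "real \<Rightarrow> 'w \<Rightarrow> 'e"
    and Q :: "real^'e^'e"
    and \<pi> \<nu> :: "'e pmf"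
    and f :: "'e \<Rightarrow> real"
  assumes "2 \<le> CARD('e)"
    and "markov_jump_process M P X"
    and "irreducible_process P X"
    and "has_Q_matrix P X Q"
    and "invariant_distribution Q \<pi>"
    and "\<not> (\<exists>c. \<forall>x. f x = c)"
    and "measure_pmf.expectation \<pi> f = 0"
  shows "(\<forall>t>0. \<forall>u\<ge>0.
            ereal (mixture_prob \<nu> P {\<omega> \<in> space M. u \<le> additive_functional X f t \<omega> / t})
              \<le> ereal (l2_norm \<pi> (rn_density \<nu> \<pi>))
                  * exp_ereal (- (ereal t * fenchel_conjugate (lambda0 \<pi> ((*v) Q) f) u)))
       \<and> (\<forall>u\<ge>0. fenchel_conjugate (lambda0 \<pi> ((*v) Q) f) u
                    = (SUP r\<in>{0..}. ereal (r * u - lambda0 \<pi> ((*v) Q) f r)))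
       \<and> (\<forall>u. fenchel_conjugate (lambda0 \<pi> ((*v) Q) f) u = rate_I \<pi> ((*v) Q) f u)"
proof -
  have pos: "0 < pmf \<pi> x" for x
    by (rule invariant_distribution_pos[OF assms(3-5)])
  have Q: "is_Q_matrix Q"
    using assms(4) by (simp add: has_Q_matrix_def)
  have f0: "(\<Sum>x\<in>UNIV. f x * pmf \<pi> x) = 0"
    using assms(7) by (simp add: integral_measure_pmf_real[of UNIV])
  note slopes = fenchel_conjugate_lambda0_nonneg_slopes[OF pos Q assms(5) f0]
  have "ereal (mixture_prob \<nu> P {\<omega> \<in> space M. u \<le> additive_functional X f t \<omega> / t})
      \<le> ereal (l2_norm \<pi> (rn_density \<nu> \<pi>))
        * exp_ereal (- (ereal t * fenchel_conjugate (lambda0 \<pi> ((*v) Q) f) u))"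
    if "0 < t" "0 \<le> u" for t u
    unfolding slopes[OF that(2)]
    by (rule le_exp_SUP)
      (use that chernoff_bound[OF assms(2,4) pos that(1)] in \<open>auto simp: l2_norm_nonneg\<close>)
  moreover note slopes
  moreover have "fenchel_conjugate (lambda0 \<pi> ((*v) Q) f) u = rate_I \<pi> ((*v) Q) f u" for u
    by (rule fenchel_conjugate_lambda0_eq_rate[OF pos Q assms(5)])
  ultimately show ?thesis by blast
qed

end
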